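(* Let $F$ and the stochastic gradients satisfy the $G$-Lipschitz assumption and let $F$ be $\lambda$-strongly convex over $\mathcal{W}$, $\lambda>0$. Let $x_T$ be the $T$-th iterate of SGD run with the step sizes $$\alpha_t=2^{-i}\frac{1}{\lambda t}\quad\text{when } T_i<t\le T_{i+1},\ 0\le i\le k .$$ Then: (1) $$\mathbb{E}[F(x_T)]\le F(x^* )+\frac{130G^2}{\lambda T}.$$ (2) There is an absolute constant $K$ such that for every $0<\delta\le \frac1e$, with probability at least $1-\delta$, $$F(x_T)\le F(x^* )+K\,\frac{G^2\log(1/\delta)}{\lambda T}.$$ (3) If instead the iterates are produced by the deterministic (sub)gradient descent update $x_{t+1}=\Pi_{\mathcal{W}}(x_t-\alpha_t\nabla F(x_t))$ with the same step sizes, where $\nabla F(x_t)\in\partial F(x_t)$ denotes a subgradient, then $$F(x_T)\le F(x^* )+\frac{130G^2}{\lambda T}.$$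
   Context: Setting. $\mathcal{W}\subset\mathbb{R}^d$ is a closed convex set, $F:\mathbb{R}^d\to\mathbb{R}$ is a convex function, and $x^*\in\mathcal{W}$ is a global minimizer of $F$. $\|\cdot\|$ is the Euclidean norm, $\partial F(x)$ the subdifferential, and $\Pi_{\mathcal{W}}$ the Euclidean projection onto $\mathcal{W}$. At each time step $t$ one has access to a random map $\hat g_t$ with $\mathbb{E}[\hat g_t(x)]=g_t(x)\in\partial F(x)$ for every $x\in\mathcal{W}$; these estimates (and the noises $\hat g_t-g_t$) are independent across $t$. SGD with step sizes $\alpha_t\ge 0$: starting from a point $x_1\in\mathcal{W}$, set $x_{t+1}=\Pi_{\mathcal{W}}(x_t-\alpha_t\hat g_t(x_t))$. $G$-Lipschitz assumption: $\|g(x)\|\le G$ for every $x\in\mathcal{W}$ and every $g(x)\in\partial F(x)$, and $\|\hat g_t(x)\|\le G$ almost surely for every $x\in\mathcal{W}$ and every $t$. $\lambda$-strong convexity over $\mathcal{W}$: $F(y)\ge F(x)+\langle g,y-x\rangle+\frac{\lambda}{2}\|y-x\|^2$ for all $x,y\in\mathcal{W}$ and $g\in\partial F(x)$. Times $T_i$: for an integer $T\ge1$, $k:=\inf\{i\ge 0: T\cdot 2^{-i}\le 1\}$, $T_i:=T-\lceil T\cdot 2^{-i}\rceil$ for $0\le i\le k$, and $T_{k+1}:=T$. *)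

theory Defs
  imports "HOL-Probability.Probability"
begin

definition subdifferential :: "('a::real_inner \<Rightarrow> real) \<Rightarrow> 'a \<Rightarrow> 'a set" where
  "subdifferential F x = {g. \<forall>y. F y \<ge> F x + g \<bullet> (y - x)}"

definition strongly_convex_over :: "real \<Rightarrow> 'a::real_inner set \<Rightarrow> ('a \<Rightarrow> real) \<Rightarrow> bool" where
  "strongly_convex_over lam W F \<longleftrightarrow>
     (\<forall>x\<in>W. \<forall>y\<in>W. \<forall>g\<in>subdifferential F x.
        F y \<ge> F x + g \<bullet> (y - x) + lam / 2 * (norm (y - x))\<^sup>2)"

(* The random maps g t w : W -> 'a are independent across t. Joint measurability in (x, w) is what
   makes g t w (X w) a random variable for a random point X. It is required with respect to the
   sigma-algebras A t that are independent: independence of the evaluations g t w x at fixed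
   points x alone would not make g t independent of a random point X that depends on earlier maps
   (a map may be modified at one random point without changing the law of any evaluation). *)
definition (in prob_space) indep_random_maps ::
    "'b::euclidean_space set \<Rightarrow> (nat \<Rightarrow> 'a \<Rightarrow> 'b \<Rightarrow> 'b) \<Rightarrow> nat set \<Rightarrow> bool" where
  "indep_random_maps W g I \<longleftrightarrow>
     (\<exists>A. indep_sets (\<lambda>t. sets (A t)) I \<and>
        (\<forall>t\<in>I. subalgebra M (A t) \<and>
           (\<lambda>(x, w). g t w x) \<in> borel_measurable (restrict_space borel W \<Otimes>\<^sub>M A t)))"

definition num_phases :: "nat \<Rightarrow> nat" where
  "num_phases T = Inf {i. real T / 2 ^ i \<le> 1}"

definition phase_time :: "nat \<Rightarrow> nat \<Rightarrow> nat" where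
  "phase_time T i = (if i \<le> num_phases T then T - nat \<lceil>real T / 2 ^ i\<rceil> else T)"

(* An absolute constant. The dimension and the sample space enter the high-probability bound as
   type variables, which are quantified outermost, so a constant bound by an existential
   quantifier there could depend on them. A closed numeral cannot; its size is immaterial. *)
definition hp_const :: real where
  "hp_const = 10 ^ 9"

end

theory Submission
  imports Defs
begin

text \<open>
  The step sizes are \<open>\<kappa> / (\<lambda> t)\<close>, where the factor \<open>\<kappa>\<close> halves each time the number
  \<open>r = T - t\<close> of remaining steps halves; all that matters is \<open>r / T < \<kappa> \<le> 2 r / T\<close>, and \<open>\<kappa> = 1\<close>
  in the first half.

  During the first half strong convexity contracts the squared distance \<open>D\<close> to the minimizer, with
  steps \<open>1 / (\<lambda> t)\<close>, so that \<open>D\<close> is of order \<open>G\<^sup>2 / (\<lambda>\<^sup>2 T)\<close> at time \<open>T / 2\<close>.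

  During the second half the iterate is compared with an anchor point \<open>z\<close> that starts at the
  minimizer and is pulled towards the iterates at a growing rate; weights \<open>u\<close> before and \<open>u'\<close>
  after a step measure the squared distance between the two. Let
  \<open>z' = z + p (x - z)\<close> with \<open>p = q / (1 + q)\<close>. If \<open>q = 2 \<alpha> u'\<close>, then convexity bounds the
  increase of \<open>F\<close> at the anchor by exactly the part of the one-step inequality that
  \<open>u' \<parallel>x' - z'\<parallel>\<^sup>2\<close> does not use up. Hence \<open>F z + u \<parallel>x - z\<parallel>\<^sup>2\<close> is a supermartingale, apart from the
  drift \<open>u' \<alpha>\<^sup>2 G\<^sup>2\<close>, as soon as \<open>u' / (1 + q)\<^sup>2 \<le> u\<close> (\<open>potential_step\<close>). The weights
  \<open>u = \<lambda> T\<^sup>2 / (r + 1)\<^sup>2\<close> satisfy this because \<open>q \<ge> 2 / r\<close>, and since \<open>\<alpha>\<close> decays like \<open>r\<close>, each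
  drift term is of order \<open>G\<^sup>2 / (\<lambda> T\<^sup>2)\<close>: the sum has no logarithm
  (\<open>weight_recursion\<close>). At the end \<open>u\<close> is of order \<open>T\<^sup>2\<close>, so the last iterate is almost as
  good as the anchor by the Lipschitz property alone.

  The noise enters both halves linearly, through \<open>\<langle>v - h, V\<rangle>\<close> with \<open>V\<close> a multiple of \<open>x - z\<close>
  determined by the past. By Hoeffding's lemma it costs \<open>G\<^sup>2 \<parallel>V\<parallel>\<^sup>2 / 2\<close> in an exponential moment, and
  this is paid for by the part of \<open>\<parallel>x - z\<parallel>\<^sup>2\<close> that each step discards. The result,
  \<open>exp_moment_last_iterate\<close>, bounds \<open>E exp (\<theta> (F x\<^sub>T - F x\<^sup>* - 73 G\<^sup>2 / (\<lambda> T)))\<close> by \<open>1\<close> for all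
  \<open>\<theta> \<le> \<lambda> T / (400 G\<^sup>2)\<close>. Jensen's inequality turns it into the bound in expectation, Markov's
  inequality into the bound in probability, and the one-point probability space gives the
  deterministic statement.
\<close>

section \<open>Projected subgradient steps on a strongly convex function\<close>

locale lipschitz_strongly_convex =
  fixes W :: "'b::euclidean_space set" and F :: "'b \<Rightarrow> real"
    and xstar :: 'b and G lam :: real
  assumes closed_W: "closed W" and convex_W: "convex W"
    and convex_F: "convex_on UNIV F"
    and xstar_in: "xstar \<in> W" and xstar_min: "F xstar \<le> F y"
    and subgradient_exists: "x \<in> W \<Longrightarrow> subdifferential F x \<noteq> {}"
    and subgradient_bound: "x \<in> W \<Longrightarrow> v \<in> subdifferential F x \<Longrightarrow> norm v \<le> G"
    and lam_pos: "lam > 0"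
    and strongly_convex: "strongly_convex_over lam W F"
begin

lemma G_nonneg: "0 \<le> G"
  using subgradient_exists[OF xstar_in] subgradient_bound[OF xstar_in]
  by (meson ex_in_conv norm_ge_zero order_trans)

lemma gap_nonneg: "0 \<le> F x - F xstar"
  using xstar_min[of x] by simp

lemma strongly_convexD:
  assumes "x \<in> W" "y \<in> W" "v \<in> subdifferential F x"
  shows "F x + v \<bullet> (y - x) + lam / 2 * (norm (y - x))\<^sup>2 \<le> F y"
  using strongly_convex assms unfolding strongly_convex_over_def by blast

text \<open>
  Strong convexity at the minimizer, where the zero vector is a subgradient.
\<close>
lemma quadratic_growth:
  assumes "x \<in> W"
  shows "lam / 2 * (norm (x - xstar))\<^sup>2 \<le> F x - F xstar"
proof -
  have "0 \<in> subdifferential F xstar"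
    using xstar_min by (simp add: subdifferential_def)
  from strongly_convexD[OF xstar_in assms this] show ?thesis by simp
qed

lemma subgradient_inner_ge:
  assumes "x \<in> W" "v \<in> subdifferential F x"
  shows "lam * (norm (x - xstar))\<^sup>2 \<le> v \<bullet> (x - xstar)"
proof -
  have "v \<bullet> (xstar - x) = - (v \<bullet> (x - xstar))"
    by (simp add: inner_diff_right)
  with strongly_convexD[OF assms(1) xstar_in assms(2)] quadratic_growth[OF assms(1)]
  show ?thesis by (simp add: norm_minus_commute)
qed

text \<open>
  A function that is both Lipschitz and strongly convex can only live on a bounded set: the
  subgradient at \<open>x\<close> has norm at least \<open>lam * norm (x - xstar)\<close>. Hence the iterates, and the values of
  \<open>F\<close> along them, stay bounded.
\<close>
lemma distance_le:
  assumes "x \<in> W"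
  shows "lam * norm (x - xstar) \<le> G"
proof (cases "x = xstar")
  case False
  obtain v where v: "v \<in> subdifferential F x"
    using subgradient_exists[OF assms] by blast
  have "lam * (norm (x - xstar))\<^sup>2 \<le> norm v * norm (x - xstar)"
    using subgradient_inner_ge[OF assms v] norm_cauchy_schwarz order_trans by blast
  also have "\<dots> \<le> G * norm (x - xstar)"
    by (intro mult_right_mono subgradient_bound[OF assms v]) simp
  finally have "(lam * norm (x - xstar)) * norm (x - xstar) \<le> G * norm (x - xstar)"
    by (simp add: power2_eq_square)
  with False show ?thesis by (simp add: mult_le_cancel_right)
qed (simp add: G_nonneg)

lemma gap_le_distance:
  assumes "x \<in> W"
  shows "F x - F y \<le> G * norm (x - y)"
proof -
  obtain v where v: "v \<in> subdifferential F x"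
    using subgradient_exists[OF assms] by blast
  have "F x + v \<bullet> (y - x) \<le> F y" using v by (simp add: subdifferential_def)
  moreover have "v \<bullet> (y - x) = - (v \<bullet> (x - y))" by (simp add: inner_diff_right)
  moreover have "v \<bullet> (x - y) \<le> norm v * norm (x - y)" by (rule norm_cauchy_schwarz)
  moreover have "\<dots> \<le> G * norm (x - y)"
    by (intro mult_right_mono subgradient_bound[OF assms v]) simp
  ultimately show ?thesis by linarith
qed

lemma gap_le:
  assumes "x \<in> W"
  shows "F x - F xstar \<le> G\<^sup>2 / lam"
proof -
  have "F x - F xstar \<le> G * norm (x - xstar)" by (rule gap_le_distance[OF assms])
  also have "\<dots> \<le> G * (G / lam)"
    using distance_le[OF assms] lam_pos G_nonneg
    by (intro mult_left_mono) (auto simp: field_simps)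
  finally show ?thesis by (simp add: power2_eq_square)
qed

lemma projection_in: "closest_point W y \<in> W"
  using closed_W xstar_in by (intro closest_point_in_set) auto

text \<open>
  The projection does not increase the distance to a point \<open>z\<close> of \<open>W\<close>; then expand the square.
\<close>
lemma projected_step_distance:
  assumes "z \<in> W"
  shows "(norm (closest_point W (x - a *\<^sub>R h) - z))\<^sup>2
          \<le> (norm (x - z))\<^sup>2 - 2 * a * (h \<bullet> (x - z)) + a\<^sup>2 * (norm h)\<^sup>2"
proof -
  have "dist (closest_point W (x - a *\<^sub>R h)) (closest_point W z) \<le> dist (x - a *\<^sub>R h) z"
    using convex_W closed_W assms by (intro closest_point_lipschitz) auto
  then have "norm (closest_point W (x - a *\<^sub>R h) - z) \<le> norm ((x - z) - a *\<^sub>R h)"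
    by (simp add: closest_point_self[OF assms] dist_norm algebra_simps)
  then have "(norm (closest_point W (x - a *\<^sub>R h) - z))\<^sup>2 \<le> (norm ((x - z) - a *\<^sub>R h))\<^sup>2"
    by (intro power_mono) auto
  also have "\<dots> = (norm (x - z))\<^sup>2 - 2 * a * (h \<bullet> (x - z)) + a\<^sup>2 * (norm h)\<^sup>2"
    unfolding power2_norm_eq_inner
    by (simp add: inner_diff_left inner_diff_right inner_commute algebra_simps power2_eq_square)
  finally show ?thesis .
qed

text \<open>
  Strong convexity used twice, at \<open>x\<close> and at the minimizer, contracts by \<open>2 * lam * a\<close>, and not
  just \<open>lam * a\<close>; with \<open>a = 1 / (lam * t)\<close> this is what makes \<open>t * D\<close> stay bounded.
\<close>
lemma step_towards_minimizer:
  assumes "x \<in> W" "v \<in> subdifferential F x" "norm h \<le> G" "0 \<le> a"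
  shows "(norm (closest_point W (x - a *\<^sub>R h) - xstar))\<^sup>2
          \<le> (1 - 2 * lam * a) * (norm (x - xstar))\<^sup>2 + a\<^sup>2 * G\<^sup>2
             + 2 * a * ((x - xstar) \<bullet> (v - h))"
proof -
  have "2 * a * (lam * (norm (x - xstar))\<^sup>2) \<le> 2 * a * (v \<bullet> (x - xstar))"
    using subgradient_inner_ge[OF assms(1,2)] assms(4) by (intro mult_left_mono) auto
  moreover have "a\<^sup>2 * (norm h)\<^sup>2 \<le> a\<^sup>2 * G\<^sup>2"
    using assms(3) by (intro mult_left_mono power_mono) auto
  moreover have "2 * a * ((x - xstar) \<bullet> (v - h))
                   = 2 * a * (v \<bullet> (x - xstar)) - 2 * a * (h \<bullet> (x - xstar))"
    by (simp add: inner_commute[of "x - xstar" "v - h"] inner_diff_left[of v h] right_diff_distrib)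
  moreover have "(1 - 2 * lam * a) * (norm (x - xstar))\<^sup>2
                   = (norm (x - xstar))\<^sup>2 - 2 * a * (lam * (norm (x - xstar))\<^sup>2)"
    by (simp add: algebra_simps)
  ultimately show ?thesis
    using projected_step_distance[OF xstar_in, of x a h] by linarith
qed

text \<open>
  The one-step inequality is applied with the new anchor \<open>z'\<close> as reference point. As
  \<open>x - z' = (1 - p) *\<^sub>R (x - z)\<close>, moving the anchor first shrinks the squared distance by
  \<open>(1 - p)\<^sup>2 = 1 / (1 + q)\<^sup>2\<close>. Convexity gives \<open>F z' - F z \<le> q * (F x - F z')\<close>, and the choice
  \<open>q = 2 * a * u\<close> makes the right-hand side \<open>u\<close> times the descent \<open>2 * a * (F x - F z')\<close>.
\<close>
lemma potential_step:
  fixes x z v h :: 'b and a u :: real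
  defines "q \<equiv> 2 * a * u"
  defines "p \<equiv> q / (1 + q)"
  defines "z' \<equiv> z + p *\<^sub>R (x - z)"
  defines "x' \<equiv> closest_point W (x - a *\<^sub>R h)"
  assumes x: "x \<in> W" and z: "z \<in> W" and v: "v \<in> subdifferential F x" and h: "norm h \<le> G"
    and a: "0 < a" and u: "0 < u"
  shows "F z' + u * (norm (x' - z'))\<^sup>2
          \<le> F z + u / (1 + q)\<^sup>2 * (norm (x - z))\<^sup>2 + u * a\<^sup>2 * G\<^sup>2 + (p *\<^sub>R (x - z)) \<bullet> (v - h)"
proof -
  have q: "0 < q" using a u by (simp add: q_def)
  have p: "0 < p" "p < 1" using q by (auto simp: p_def field_simps)
  have one_p: "1 - p = 1 / (1 + q)" using q by (simp add: p_def field_simps)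
  have z'_eq: "z' = (1 - p) *\<^sub>R z + p *\<^sub>R x"
    by (simp add: z'_def algebra_simps)
  have z': "z' \<in> W"
    unfolding z'_eq using convex_W x z p by (intro convexD) auto
  have x_z': "x - z' = (1 - p) *\<^sub>R (x - z)" by (simp add: z'_def algebra_simps)
  have cvx: "F z' \<le> (1 - p) * F z + p * F x"
    unfolding z'_eq using convex_onD[OF convex_F, of p z x] p by simp
  have sub: "F x - F z' \<le> v \<bullet> (x - z')"
    using v by (simp add: subdifferential_def inner_diff_right) (smt (verit, best))
  have h2: "a\<^sup>2 * (norm h)\<^sup>2 \<le> a\<^sup>2 * G\<^sup>2"
    using h by (intro mult_left_mono power_mono) auto
  have "(norm (x' - z'))\<^sup>2
          \<le> (norm (x - z'))\<^sup>2 - 2 * a * (h \<bullet> (x - z')) + a\<^sup>2 * G\<^sup>2"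
    using projected_step_distance[OF z', of x a h] h2 unfolding x'_def by linarith
  also have "h \<bullet> (x - z') = v \<bullet> (x - z') - (x - z') \<bullet> (v - h)"
    by (simp add: inner_diff_right inner_diff_left inner_commute)
  finally have "2 * a * (v \<bullet> (x - z')) + (norm (x' - z'))\<^sup>2
          \<le> (norm (x - z'))\<^sup>2 + 2 * a * ((x - z') \<bullet> (v - h)) + a\<^sup>2 * G\<^sup>2"
    by (simp add: algebra_simps)
  moreover have "2 * a * (F x - F z') \<le> 2 * a * (v \<bullet> (x - z'))"
    using sub a by (intro mult_left_mono) auto
  ultimately have "2 * a * (F x - F z') + (norm (x' - z'))\<^sup>2
          \<le> (norm (x - z'))\<^sup>2 + 2 * a * ((x - z') \<bullet> (v - h)) + a\<^sup>2 * G\<^sup>2"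
    by linarith
  then have "u * (2 * a * (F x - F z') + (norm (x' - z'))\<^sup>2)
          \<le> u * ((norm (x - z'))\<^sup>2 + 2 * a * ((x - z') \<bullet> (v - h)) + a\<^sup>2 * G\<^sup>2)"
    using u by (intro mult_left_mono) auto
  then have main: "q * (F x - F z') + u * (norm (x' - z'))\<^sup>2
          \<le> u * (norm (x - z'))\<^sup>2 + q * ((x - z') \<bullet> (v - h)) + u * a\<^sup>2 * G\<^sup>2"
    by (simp add: q_def algebra_simps)
  have "F z' - F z \<le> q * (F x - F z')"
  proof -
    have "(1 + q) * F z' \<le> (1 + q) * ((1 - p) * F z + p * F x)"
      using cvx q by (intro mult_left_mono) auto
    also have "\<dots> = ((1 + q) * (1 - p)) * F z + ((1 + q) * p) * F x"
      by (simp add: algebra_simps)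
    also have "\<dots> = F z + q * F x"
      unfolding one_p using q by (simp add: p_def)
    finally show ?thesis by (simp add: algebra_simps)
  qed
  moreover have "u * (norm (x - z'))\<^sup>2 = u / (1 + q)\<^sup>2 * (norm (x - z))\<^sup>2"
    using q by (simp add: x_z' one_p power_mult_distrib power_divide)
  moreover have "q * ((x - z') \<bullet> (v - h)) = (p *\<^sub>R (x - z)) \<bullet> (v - h)"
    unfolding x_z' one_p by (simp add: p_def)
  ultimately show ?thesis
    using main by linarith
qed

end

section \<open>Exponential moments\<close>

text \<open>
  Jensen's inequality for the concave power \<open>\<rho>\<close>, by integrating the chord bound
  \<open>exp (\<rho> * s) \<le> \<rho> * exp s + (1 - \<rho>)\<close> at \<open>s = Y w - b\<close>. It turns a contraction of the exponent
  into a contraction of the bound \<open>b\<close>.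
\<close>
lemma (in prob_space) nn_integral_exp_scale:
  fixes Y :: "'a \<Rightarrow> real"
  assumes [measurable]: "Y \<in> borel_measurable M"
    and Y: "(\<integral>\<^sup>+ w. ennreal (exp (Y w)) \<partial>M) \<le> ennreal (exp b)"
    and \<rho>: "0 \<le> \<rho>" "\<rho> \<le> 1"
  shows "(\<integral>\<^sup>+ w. ennreal (exp (\<rho> * Y w)) \<partial>M) \<le> ennreal (exp (\<rho> * b))"
proof -
  have pt: "exp (\<rho> * Y w) \<le> exp (\<rho> * b) * (\<rho> * exp (- b) * exp (Y w) + (1 - \<rho>))" for w
  proof -
    have "exp ((1 - \<rho>) *\<^sub>R 0 + \<rho> *\<^sub>R (Y w - b)) \<le> (1 - \<rho>) * exp 0 + \<rho> * exp (Y w - b)"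
      using convex_onD[OF convex_on_exp[of 1], of \<rho> 0 "Y w - b"] \<rho> by simp
    then have "exp (\<rho> * b) * exp (\<rho> * (Y w - b))
                 \<le> exp (\<rho> * b) * ((1 - \<rho>) + \<rho> * exp (Y w - b))"
      by (intro mult_left_mono) auto
    moreover have "exp (\<rho> * b) * exp (\<rho> * (Y w - b)) = exp (\<rho> * Y w)"
      by (simp add: exp_add[symmetric] algebra_simps)
    moreover have "exp (Y w - b) = exp (- b) * exp (Y w)"
      by (simp add: exp_add[symmetric])
    ultimately show ?thesis by (simp add: algebra_simps)
  qed
  have "(\<integral>\<^sup>+ w. ennreal (exp (\<rho> * Y w)) \<partial>M)
          \<le> (\<integral>\<^sup>+ w. ennreal (exp (\<rho> * b)) *
               (ennreal (\<rho> * exp (- b)) * ennreal (exp (Y w)) + ennreal (1 - \<rho>)) \<partial>M)"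
  proof (intro nn_integral_mono)
    fix w
    have "ennreal (exp (\<rho> * Y w))
            \<le> ennreal (exp (\<rho> * b) * (\<rho> * exp (- b) * exp (Y w) + (1 - \<rho>)))"
      using pt by (intro ennreal_leI)
    also have "\<dots> = ennreal (exp (\<rho> * b)) *
               (ennreal (\<rho> * exp (- b)) * ennreal (exp (Y w)) + ennreal (1 - \<rho>))"
      using \<rho> by (simp add: ennreal_mult' ennreal_plus ennreal_mult'')
    finally show "ennreal (exp (\<rho> * Y w)) \<le> \<dots>" .
  qed
  also have "\<dots> = ennreal (exp (\<rho> * b)) *
      (ennreal (\<rho> * exp (- b)) * (\<integral>\<^sup>+ w. ennreal (exp (Y w)) \<partial>M) + ennreal (1 - \<rho>))"
    by (simp add: nn_integral_cmult nn_integral_add emeasure_space_1)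
  also have "\<dots> \<le> ennreal (exp (\<rho> * b)) *
      (ennreal (\<rho> * exp (- b)) * ennreal (exp b) + ennreal (1 - \<rho>))"
    by (intro mult_left_mono add_right_mono Y) auto
  also have "\<dots> = ennreal (exp (\<rho> * b))"
    using \<rho> by (simp flip: ennreal_mult' ennreal_plus ennreal_mult'' add: mult.assoc exp_add[symmetric])
  finally show ?thesis .
qed

text \<open>
  Integrate \<open>1 + s \<le> exp s\<close>.
\<close>
lemma (in prob_space) expectation_le_if_exp_moment:
  fixes Y :: "'a \<Rightarrow> real"
  assumes Y: "integrable M Y" and \<theta>: "0 < \<theta>"
    and exp: "(\<integral>\<^sup>+ w. ennreal (exp (\<theta> * (Y w - b))) \<partial>M) \<le> 1"
  shows "expectation Y \<le> b"
proof -
  note [measurable] = borel_measurable_integrable[OF Y]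
  have int: "integrable M (\<lambda>w. exp (\<theta> * (Y w - b)))"
    using exp by (intro integrableI_nonneg) (auto simp: top_unique less_top[symmetric])
  have "1 + \<theta> * (expectation Y - b) = expectation (\<lambda>w. 1 + \<theta> * (Y w - b))"
    using Y by (simp add: prob_space)
  also have "\<dots> \<le> expectation (\<lambda>w. exp (\<theta> * (Y w - b)))"
    using Y int by (intro integral_mono) (auto simp: exp_ge_add_one_self)
  also have "\<dots> \<le> 1"
    using exp int by (simp add: nn_integral_eq_integral)
  finally show ?thesis using \<theta> by (simp add: mult_le_0_iff)
qed

text \<open>
  Markov's inequality for the exponential.
\<close>
lemma (in prob_space) prob_le_if_exp_moment:
  fixes Y :: "'a \<Rightarrow> real"
  assumes [measurable]: "Y \<in> borel_measurable M" and \<theta>: "0 < \<theta>"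
    and exp: "(\<integral>\<^sup>+ w. ennreal (exp (\<theta> * (Y w - b))) \<partial>M) \<le> 1"
  shows "1 - exp (- L) \<le> prob {w \<in> space M. Y w \<le> b + L / \<theta>}"
proof -
  let ?B = "{w \<in> space M. b + L / \<theta> < Y w}"
  have "ennreal (exp L) * emeasure M ?B = (\<integral>\<^sup>+ w. ennreal (exp L) * indicator ?B w \<partial>M)"
    by (simp add: nn_integral_cmult_indicator)
  also have "\<dots> \<le> (\<integral>\<^sup>+ w. ennreal (exp (\<theta> * (Y w - b))) \<partial>M)"
    using \<theta> by (intro nn_integral_mono) (auto split: split_indicator simp: field_simps)
  finally have "ennreal (exp L) * emeasure M ?B \<le> 1" using exp by simp
  then have "exp L * prob ?B \<le> 1"
    by (simp add: emeasure_eq_measure flip: ennreal_mult' ennreal_mult'')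
  then have "prob ?B \<le> exp (- L)"
    by (simp add: exp_minus field_simps)
  moreover have "prob {w \<in> space M. Y w \<le> b + L / \<theta>} = 1 - prob ?B"
    by (subst prob_compl[symmetric]) (auto intro!: arg_cong[where f = prob])
  ultimately show ?thesis by simp
qed

section \<open>Step sizes and weights\<close>

text \<open>
  What the analysis needs to know about the step sizes: the factor \<open>\<kappa>\<close> follows the fraction of
  remaining steps up to a factor two. The value \<open>\<kappa> = 1\<close> in the first half is not implied by
  these two bounds.
\<close>
definition halving_steps :: "real \<Rightarrow> nat \<Rightarrow> (nat \<Rightarrow> real) \<Rightarrow> bool" where
  "halving_steps lam T \<alpha> \<longleftrightarrow> (\<forall>t. 1 \<le> t \<longrightarrow> t < T \<longrightarrow>
     (\<exists>\<kappa>. \<alpha> t = \<kappa> / (lam * real t) \<and> real (T - t) / real T < \<kappa> \<and>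
          \<kappa> \<le> 2 * real (T - t) / real T \<and> (2 * t \<le> T \<longrightarrow> \<kappa> = 1)))"

text \<open>
  The phase of \<open>t\<close> is the \<open>i\<close> with \<open>T / 2 ^ (i + 1) \<le> T - t < T / 2 ^ i\<close>. Since \<open>T - t\<close> is an
  integer, the ceilings in the phase boundaries have no effect on these comparisons.
\<close>
lemma phase_of_time:
  assumes "1 \<le> t" "t < T"
  obtains i where "i \<le> num_phases T" "phase_time T i < t" "t \<le> phase_time T (i + 1)"
    "real (T - t) / real T < 1 / 2 ^ i" "1 / 2 ^ i \<le> 2 * real (T - t) / real T"
proof -
  define r where "r = T - t"
  define k where "k = num_phases T"
  have r: "1 \<le> r" "r < T" using assms by (auto simp: r_def)
  have "k \<in> {i. real T / 2 ^ i \<le> 1}"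
    unfolding k_def num_phases_def
  proof (rule Inf_nat_def1)
    obtain n where "real T < 2 ^ n" using real_arch_pow[of 2 "real T"] by auto
    then have "n \<in> {i. real T / 2 ^ i \<le> 1}" by simp
    then show "{i. real T / 2 ^ i \<le> 1} \<noteq> {}" by blast
  qed
  then have "real T / 2 ^ k \<le> 1" by (rule CollectD)
  then have k: "real T / 2 ^ k \<le> real r" using r by linarith
  define j where "j = (LEAST j. real T / 2 ^ j \<le> real r)"
  have j: "real T / 2 ^ j \<le> real r" "j \<le> k"
    unfolding j_def using k by (auto intro: LeastI Least_le)
  have "j \<noteq> 0" using j(1) r by (cases "j = 0") auto
  then obtain i where i: "j = Suc i" using not0_implies_Suc by blast
  have lt: "real r < real T / 2 ^ i"
    using not_less_Least[of i "\<lambda>j. real T / 2 ^ j \<le> real r"] i unfolding j_def by auto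
  have ge: "real T / 2 ^ Suc i \<le> real r" using j(1) i by simp
  have pt: "phase_time T l = T - nat \<lceil>real T / 2 ^ l\<rceil>" if "l \<le> k" for l
    using that by (simp add: phase_time_def k_def)
  have "r < nat \<lceil>real T / 2 ^ i\<rceil>" using lt by (simp add: zless_nat_eq_int_zless less_ceiling_iff)
  moreover have "nat \<lceil>real T / 2 ^ Suc i\<rceil> \<le> r"
    using ge by (simp add: nat_le_iff ceiling_le_iff)
  ultimately have "phase_time T i < t" "t \<le> phase_time T (i + 1)"
    using pt[of i] pt[of "Suc i"] i j(2) assms unfolding r_def Suc_eq_plus1 by linarith+
  moreover have "real r / real T < 1 / 2 ^ i" "1 / 2 ^ i \<le> 2 * real r / real T"
    using lt ge r by (simp_all add: field_simps)
  moreover have "i \<le> num_phases T" using i j(2) by (simp add: k_def)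
  ultimately show thesis
    using that[of i] unfolding r_def by blast
qed

lemma halving_steps_if_phases:
  fixes \<alpha> :: "nat \<Rightarrow> real"
  assumes \<alpha>: "\<And>i t. i \<le> num_phases T \<Longrightarrow> phase_time T i < t \<Longrightarrow> t \<le> phase_time T (i + 1) \<Longrightarrow>
           \<alpha> t = (1 / 2 ^ i) * (1 / (lam * real t))"
  shows "halving_steps lam T \<alpha>"
  unfolding halving_steps_def
proof (intro allI impI)
  fix t assume t: "1 \<le> t" "t < T"
  obtain i where i: "i \<le> num_phases T" "phase_time T i < t" "t \<le> phase_time T (i + 1)"
    "real (T - t) / real T < 1 / 2 ^ i" "1 / 2 ^ i \<le> 2 * real (T - t) / real T"
    using t by (rule phase_of_time)
  have "i = 0" if "2 * t \<le> T"
  proof (rule ccontr)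
    assume "i \<noteq> 0"
    then have "(1 :: real) / 2 ^ i \<le> 1 / 2"
      using power_increasing[of 1 i "2 :: real"] by (simp add: field_simps)
    moreover have "1 / 2 \<le> real (T - t) / real T"
      using that t by (simp add: field_simps of_nat_diff)
    ultimately show False using i(4) by linarith
  qed
  moreover have "\<alpha> t = (1 / 2 ^ i) / (lam * real t)"
    using \<alpha>[OF i(1-3)] by simp
  ultimately show "\<exists>\<kappa>. \<alpha> t = \<kappa> / (lam * real t) \<and> real (T - t) / real T < \<kappa> \<and>
      \<kappa> \<le> 2 * real (T - t) / real T \<and> (2 * t \<le> T \<longrightarrow> \<kappa> = 1)"
    using i(4,5) by (metis div_by_1 power_0)
qed

text \<open>
  The weights are \<open>lam * s\<^sup>2 / (r + 1)\<^sup>2\<close> before a step with \<open>r\<close> remaining steps and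
  \<open>lam * s\<^sup>2 / r\<^sup>2\<close> after it. From \<open>q \<ge> 2 / r\<close> the shrinking of the distance outweighs the growth of the
  weight: the new weight counts at most \<open>lam * s\<^sup>2 / (r + 2)\<^sup>2\<close>. The gap of order \<open>lam * s\<^sup>2 / r ^ 3\<close>
  to \<open>lam * s\<^sup>2 / (r + 1)\<^sup>2\<close> pays for the noise. By \<open>q \<le> 12 / r\<close> the noise costs of order \<open>c / r\<^sup>2\<close>,
  which is less since \<open>r \<le> s\<close> and \<open>c\<close> is small compared to \<open>lam * s\<close>.

  The second bound gives the drift of one step. The assumption \<open>s \<le> 3 * t\<close> holds from the middle of the
  run on, also when that is rounded down.
\<close>
lemma weight_recursion:
  fixes r s t \<kappa> c lam :: real
  defines "q \<equiv> 2 * (\<kappa> / (lam * t)) * (lam * s\<^sup>2 / r\<^sup>2)"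
  assumes r: "1 \<le> r" "r + t = s" and t: "s \<le> 3 * t" and lam: "0 < lam"
    and \<kappa>: "r / s < \<kappa>" "\<kappa> \<le> 2 * r / s"
    and c: "0 \<le> c" "400 * c \<le> lam * s"
  shows "lam * s\<^sup>2 / r\<^sup>2 / (1 + q)\<^sup>2 + c * (q / (1 + q))\<^sup>2 / 2 \<le> lam * s\<^sup>2 / (r + 1)\<^sup>2"
    and "lam * s\<^sup>2 / r\<^sup>2 * (\<kappa> / (lam * t))\<^sup>2 \<le> 36 / (lam * s\<^sup>2)"
proof -
  have t_pos: "0 < t" and s_pos: "0 < s" and rs: "3 * r \<le> 2 * s" and ts: "t \<le> s"
    using r t by linarith+
  have \<kappa>_pos: "0 < \<kappa>" using \<kappa>(1) r s_pos by (smt (verit) divide_pos_pos)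
  have q_eq: "q = 2 * \<kappa> * s\<^sup>2 / (t * r\<^sup>2)"
    using lam by (simp add: q_def)
  have \<kappa>r: "r < \<kappa> * s" "\<kappa> * s \<le> 2 * r"
    using \<kappa> s_pos by (simp_all add: field_simps)
  have q_ge: "2 / r \<le> q"
  proof -
    have "t * r \<le> \<kappa> * s * s"
      using \<kappa>r ts r t_pos s_pos by (metis less_eq_real_def mult.commute mult_mono' order_trans zero_less_one)
    then have "2 * (t * r) * r \<le> 2 * (\<kappa> * s * s) * r"
      using r by (intro mult_right_mono) auto
    then show ?thesis
      using r t_pos by (simp add: q_eq divide_simps power2_eq_square algebra_simps)
  qed
  have q_le: "q \<le> 12 / r"
  proof -
    have "\<kappa> * s * s \<le> (2 * r) * (3 * t)"
      using \<kappa>r(2) t r(1) s_pos by - (rule mult_mono, auto)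
    then have "2 * (\<kappa> * s * s) * r \<le> 2 * ((2 * r) * (3 * t)) * r"
      using r by (intro mult_right_mono) auto
    then show ?thesis
      using r t_pos by (simp add: q_eq divide_simps power2_eq_square algebra_simps)
  qed
  have q_pos: "0 < q" using q_ge r by (smt (verit) divide_pos_pos)
  have p_le: "(q / (1 + q))\<^sup>2 \<le> 144 / r\<^sup>2"
  proof -
    have "q / (1 + q) \<le> q" using q_pos by (simp add: field_simps)
    then have "q / (1 + q) \<le> 12 / r" using q_le by linarith
    then have "(q / (1 + q))\<^sup>2 \<le> (12 / r)\<^sup>2"
      using q_pos by (intro power_mono) auto
    then show ?thesis by (simp add: power_divide)
  qed
  have "c * (q / (1 + q))\<^sup>2 / 2 \<le> (lam * s / 400) * (144 / r\<^sup>2) / 2"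
    using c p_le lam s_pos by (intro divide_right_mono mult_mono) auto
  then have A: "c * (q / (1 + q))\<^sup>2 / 2 \<le> lam * s * (9 / 50 / r\<^sup>2)"
    by (simp add: field_simps)
  have "r + 2 \<le> r * (1 + q)"
    using q_ge r by (simp add: field_simps)
  then have "(r + 2)\<^sup>2 \<le> (r * (1 + q))\<^sup>2"
    using r by (intro power_mono) auto
  then have "lam * s\<^sup>2 / (r * (1 + q))\<^sup>2 \<le> lam * s\<^sup>2 / (r + 2)\<^sup>2"
    using r lam q_pos by (intro divide_left_mono) auto
  then have B: "lam * s\<^sup>2 / r\<^sup>2 / (1 + q)\<^sup>2 \<le> lam * s\<^sup>2 / (r + 2)\<^sup>2"
    by (simp add: power_mult_distrib)
  have "9 / 50 / r\<^sup>2 \<le> (3 / 2 * r) * (1 / (r + 1)\<^sup>2 - 1 / (r + 2)\<^sup>2)"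
  proof -
    \<comment> \<open>Expanded in powers of \<open>r\<close>, the left side is dominated term by term once \<open>r \<ge> 1\<close>.\<close>
    have "r\<^sup>2 \<le> r ^ 4" "r \<le> r ^ 3" "1 \<le> r ^ 3"
      using r power_increasing[of 2 4 r] power_increasing[of 1 3 r] by auto
    then have "9 / 50 * (r ^ 4 + 6 * r ^ 3 + 13 * r\<^sup>2 + 12 * r + 4) \<le> 3 * r ^ 4 + 9 / 2 * r ^ 3"
      using r one_le_power[of r 4] unfolding distrib_left by linarith
    moreover have "(r + 1)\<^sup>2 * (r + 2)\<^sup>2 = r ^ 4 + 6 * r ^ 3 + 13 * r\<^sup>2 + 12 * r + 4"
      "(3 / 2 * r) * (2 * r + 3) * r\<^sup>2 = 3 * r ^ 4 + 9 / 2 * r ^ 3"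
      by (simp_all add: power2_eq_square power3_eq_cube power4_eq_xxxx algebra_simps)
    ultimately have "9 / 50 * ((r + 1)\<^sup>2 * (r + 2)\<^sup>2) \<le> (3 / 2 * r) * (2 * r + 3) * r\<^sup>2"
      by simp
    moreover have "1 / (r + 1)\<^sup>2 - 1 / (r + 2)\<^sup>2 = (2 * r + 3) / ((r + 1)\<^sup>2 * (r + 2)\<^sup>2)"
    proof -
      have "(r + 2)\<^sup>2 - (r + 1)\<^sup>2 = 2 * r + 3" by (simp add: power2_eq_square algebra_simps)
      then show ?thesis using r by (simp add: diff_frac_eq)
    qed
    ultimately show ?thesis
      using r by (simp add: divide_simps mult_ac)
  qed
  also have "\<dots> \<le> s * (1 / (r + 1)\<^sup>2 - 1 / (r + 2)\<^sup>2)"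
    using rs r by (intro mult_right_mono) (auto simp: divide_simps intro!: power_mono)
  finally have "lam * s * (9 / 50 / r\<^sup>2) \<le> lam * s * (s * (1 / (r + 1)\<^sup>2 - 1 / (r + 2)\<^sup>2))"
    using lam s_pos by (intro mult_left_mono) auto
  then have C: "lam * s * (9 / 50 / r\<^sup>2) \<le> lam * s\<^sup>2 / (r + 1)\<^sup>2 - lam * s\<^sup>2 / (r + 2)\<^sup>2"
    by (simp add: power2_eq_square algebra_simps)
  show "lam * s\<^sup>2 / r\<^sup>2 / (1 + q)\<^sup>2 + c * (q / (1 + q))\<^sup>2 / 2 \<le> lam * s\<^sup>2 / (r + 1)\<^sup>2"
    using A B C by linarith
  have "(\<kappa> * s * s)\<^sup>2 \<le> (6 * r * t)\<^sup>2"
  proof (intro power_mono)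
    have "\<kappa> * s * s \<le> (2 * r) * (3 * t)"
      using \<kappa>r(2) t r(1) s_pos by - (rule mult_mono, auto)
    then show "\<kappa> * s * s \<le> 6 * r * t" by simp
  qed (use \<kappa>_pos s_pos in auto)
  then show "lam * s\<^sup>2 / r\<^sup>2 * (\<kappa> / (lam * t))\<^sup>2 \<le> 36 / (lam * s\<^sup>2)"
    using lam r t_pos s_pos by (simp add: divide_simps power_mult_distrib power2_eq_square mult_ac)
qed

section \<open>Exponential moments along a noisy run\<close>

text \<open>
  A run with history \<open>H t\<close> before step \<open>t\<close>, where \<open>v t\<close> is a subgradient at \<open>X t\<close> and \<open>h t\<close> its
  estimate. The assumption on the noise is the conditional form of Hoeffding's lemma: given the
  history, \<open>v t - h t\<close> is centred sub-Gaussian in every direction \<open>V\<close>. Quantifying over the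
  nonnegative weights \<open>Z\<close> stands for the conditional expectation. A run without noise satisfies it
  as well.
\<close>
locale noisy_subgradient_run =
  lipschitz_strongly_convex W F xstar G lam + prob_space M
  for W :: "'b::euclidean_space set" and F :: "'b \<Rightarrow> real" and xstar :: 'b and G lam :: real
    and M :: "'w measure" +
  fixes T :: nat and \<alpha> :: "nat \<Rightarrow> real"
    and H :: "nat \<Rightarrow> 'w measure" and X v h :: "nat \<Rightarrow> 'w \<Rightarrow> 'b"
  assumes T_ge: "2 \<le> T"
    and step_size: "halving_steps lam T \<alpha>"
    and X_1: "\<And>w. w \<in> space M \<Longrightarrow> X 1 w \<in> W"
    and X_step: "\<And>t w. 1 \<le> t \<Longrightarrow> t < T \<Longrightarrow> w \<in> space M \<Longrightarrow>
      X (Suc t) w = closest_point W (X t w - \<alpha> t *\<^sub>R h t w)"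
    and history: "\<And>t. subalgebra M (H t)"
    and history_grows: "\<And>t. subalgebra (H (Suc t)) (H t)"
    and X_adapted: "\<And>t. 1 \<le> t \<Longrightarrow> t \<le> T \<Longrightarrow> X t \<in> borel_measurable (H t)"
    and subgradient: "\<And>t w. 1 \<le> t \<Longrightarrow> t < T \<Longrightarrow> w \<in> space M \<Longrightarrow>
      v t w \<in> subdifferential F (X t w)"
    and estimate_bound: "\<And>t. 1 \<le> t \<Longrightarrow> t < T \<Longrightarrow> AE w in M. norm (h t w) \<le> G"
    and noise_sub_gaussian: "\<And>t Z V. 1 \<le> t \<Longrightarrow> t < T \<Longrightarrow>
      Z \<in> borel_measurable (H t) \<Longrightarrow> V \<in> borel_measurable (H t) \<Longrightarrow>
      (\<integral>\<^sup>+ w. Z w * ennreal (exp (V w \<bullet> (v t w - h t w))) \<partial>M)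
        \<le> (\<integral>\<^sup>+ w. Z w * ennreal (exp (G\<^sup>2 * (norm (V w))\<^sup>2 / 2)) \<partial>M)"
begin

lemma measurable_history: "Y \<in> measurable (H t) N \<Longrightarrow> Y \<in> measurable M N"
  by (rule measurable_from_subalg[OF history])

lemma measurable_history_Suc: "Y \<in> measurable (H t) N \<Longrightarrow> Y \<in> measurable (H (Suc t)) N"
  by (rule measurable_from_subalg[OF history_grows])

lemma space_history: "space (H t) = space M"
  using history by (simp add: subalgebra_def)

lemma F_borel [measurable]: "F \<in> borel_measurable borel"
  using convex_on_continuous[OF open_UNIV convex_F] by (rule borel_measurable_continuous_onI)

lemma X_in: "1 \<le> t \<Longrightarrow> t \<le> T \<Longrightarrow> w \<in> space M \<Longrightarrow> X t w \<in> W"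
  by (induction t rule: nat_induct_at_least) (auto simp: X_1 [simplified] X_step projection_in)

text \<open>
  The shape of every step: a pathwise inequality that is linear in the noise, and a drift condition
  that has to absorb the price \<open>G\<^sup>2 * (norm (V w))\<^sup>2 / 2\<close> of averaging the noise out.
\<close>
lemma exp_moment_step:
  fixes Y' Y U :: "'w \<Rightarrow> real" and V :: "'w \<Rightarrow> 'b"
  assumes t: "1 \<le> t" "t < T"
    and meas: "Y \<in> borel_measurable (H t)" "V \<in> borel_measurable (H t)"
      "U \<in> borel_measurable (H t)"
    and step: "AE w in M. Y' w \<le> Y w + V w \<bullet> (v t w - h t w)"
    and drift: "\<And>w. w \<in> space M \<Longrightarrow> Y w + G\<^sup>2 * (norm (V w))\<^sup>2 / 2 \<le> \<rho> * U w + c"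
    and \<rho>: "0 \<le> \<rho>" "\<rho> \<le> 1"
    and U: "(\<integral>\<^sup>+ w. ennreal (exp (U w)) \<partial>M) \<le> ennreal (exp b)"
  shows "(\<integral>\<^sup>+ w. ennreal (exp (Y' w)) \<partial>M) \<le> ennreal (exp (\<rho> * b + c))"
proof -
  note [measurable] = meas(3)[THEN measurable_history]
  have "(\<integral>\<^sup>+ w. ennreal (exp (Y' w)) \<partial>M)
      \<le> (\<integral>\<^sup>+ w. ennreal (exp (Y w)) * ennreal (exp (V w \<bullet> (v t w - h t w))) \<partial>M)"
    using step by (intro nn_integral_mono_AE) (auto simp flip: ennreal_mult' exp_add elim!: eventually_mono)
  also have "\<dots> \<le> (\<integral>\<^sup>+ w. ennreal (exp (Y w)) * ennreal (exp (G\<^sup>2 * (norm (V w))\<^sup>2 / 2)) \<partial>M)"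
    using meas by (intro noise_sub_gaussian t) measurable
  also have "\<dots> \<le> (\<integral>\<^sup>+ w. ennreal (exp c) * ennreal (exp (\<rho> * U w)) \<partial>M)"
    using drift by (intro nn_integral_mono) (auto simp: add.commute simp flip: ennreal_mult' exp_add)
  also have "\<dots> = ennreal (exp c) * (\<integral>\<^sup>+ w. ennreal (exp (\<rho> * U w)) \<partial>M)"
    by (simp add: nn_integral_cmult)
  also have "\<dots> \<le> ennreal (exp c) * ennreal (exp (\<rho> * b))"
    by (intro mult_left_mono nn_integral_exp_scale U \<rho>) auto
  also have "\<dots> = ennreal (exp (\<rho> * b + c))"
    by (simp add: exp_add ennreal_mult' mult.commute)
  finally show ?thesis .
qed

lemmas step_factor = step_size[unfolded halving_steps_def, rule_format]

lemma step_size_pos: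
  assumes "1 \<le> t" "t < T"
  shows "0 < \<alpha> t"
proof -
  obtain \<kappa> where \<kappa>: "\<alpha> t = \<kappa> / (lam * real t)" "real (T - t) / real T < \<kappa>"
    using step_factor[OF assms] by blast
  have "0 \<le> real (T - t) / real T" by simp
  with \<kappa>(2) have "0 < \<kappa>" by linarith
  then show ?thesis using \<kappa>(1) lam_pos assms by simp
qed

lemma initial_phase_step_size:
  assumes "1 \<le> t" "2 * t \<le> T"
  shows "\<alpha> t = 1 / (lam * real t)"
  using step_factor[OF assms(1)] T_ge assms(2) by auto

text \<open>
  From \<open>D' \<le> (1 - 2 / t) * D + A / t\<^sup>2 + noise\<close> with \<open>A = G\<^sup>2 / lam\<^sup>2\<close>. Half of the contraction pays
  for the growth of the factor \<open>t\<close> in the exponent, and half of what is left for the noise, whose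
  variance is proportional to \<open>D\<close>. The contraction \<open>1 - 1 / (2 * t)\<close> that survives, applied to the
  bound \<open>4 * c * A\<close>, outweighs the drift \<open>c * (t + 1) * A / t\<^sup>2\<close>; without it the drift would sum up to a
  logarithm.
\<close>
lemma exp_moment_distance:
  fixes c :: real
  assumes c: "0 \<le> c" "4 * c * G\<^sup>2 \<le> lam\<^sup>2" and t: "1 \<le> t" "2 * t \<le> T"
  shows "(\<integral>\<^sup>+ w. ennreal (exp (c * real t * (norm (X t w - xstar))\<^sup>2)) \<partial>M)
          \<le> ennreal (exp (4 * c * G\<^sup>2 / lam\<^sup>2))"
  using t
proof (induction t rule: nat_induct_at_least)
  case base
  have "c * (norm (X 1 w - xstar))\<^sup>2 \<le> 4 * c * G\<^sup>2 / lam\<^sup>2" if "w \<in> space M" for w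
  proof -
    have "(lam * norm (X 1 w - xstar))\<^sup>2 \<le> G\<^sup>2"
      using distance_le[OF X_1[OF that]] lam_pos by (intro power_mono) auto
    then have "(norm (X 1 w - xstar))\<^sup>2 \<le> G\<^sup>2 / lam\<^sup>2"
      using lam_pos by (simp add: power_mult_distrib field_simps)
    then have "c * (norm (X 1 w - xstar))\<^sup>2 \<le> c * (G\<^sup>2 / lam\<^sup>2)"
      using c(1) by (rule mult_left_mono)
    moreover have "0 \<le> c * (G\<^sup>2 / lam\<^sup>2)" using c(1) by simp
    moreover have "4 * c * G\<^sup>2 / lam\<^sup>2 = 4 * (c * (G\<^sup>2 / lam\<^sup>2))" by simp
    ultimately show ?thesis by linarith
  qed
  then have "(\<integral>\<^sup>+ w. ennreal (exp (c * real 1 * (norm (X 1 w - xstar))\<^sup>2)) \<partial>M)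
         \<le> (\<integral>\<^sup>+ w. ennreal (exp (4 * c * G\<^sup>2 / lam\<^sup>2)) \<partial>M)"
    by (intro nn_integral_mono) auto
  then show ?case by (simp add: emeasure_space_1)
next
  case (Suc t)
  define D where "D w = (norm (X t w - xstar))\<^sup>2" for w
  define s where "s = c * (real t + 1)"
  define V where "V w = (2 * s / (lam * real t)) *\<^sub>R (X t w - xstar)" for w
  define A where "A = G\<^sup>2 / lam\<^sup>2"
  have t: "1 \<le> t" "t < T" "2 * t \<le> T" and t1: "1 \<le> real t" using Suc by auto
  have s: "0 \<le> s" using c by (simp add: s_def)
  have A: "0 \<le> A" "4 * c * A \<le> 1" using c lam_pos by (auto simp: A_def field_simps)
  have alpha: "\<alpha> t = 1 / (lam * real t)" using t by (intro initial_phase_step_size)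
  have [measurable]: "X t \<in> borel_measurable (H t)" using t by (intro X_adapted) auto
  have "(\<integral>\<^sup>+ w. ennreal (exp (s * (norm (X (Suc t) w - xstar))\<^sup>2)) \<partial>M)
     \<le> ennreal (exp ((1 - 1 / (2 * real t)) * (4 * c * A) + s * A / (real t)\<^sup>2))"
  proof (rule exp_moment_step[OF t(1,2), where V = V and U = "\<lambda>w. c * real t * D w"
        and Y = "\<lambda>w. s * ((1 - 2 / real t) * D w + A / (real t)\<^sup>2)"])

    show "AE w in M. s * (norm (X (Suc t) w - xstar))\<^sup>2
            \<le> s * ((1 - 2 / real t) * D w + A / (real t)\<^sup>2) + V w \<bullet> (v t w - h t w)"
      using estimate_bound[OF t(1,2)] AE_space
    proof eventually_elim
      case (elim w)
      have "(norm (X (Suc t) w - xstar))\<^sup>2 \<le> (1 - 2 * lam * \<alpha> t) * D w + (\<alpha> t)\<^sup>2 * G\<^sup>2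
             + 2 * \<alpha> t * ((X t w - xstar) \<bullet> (v t w - h t w))"
        unfolding X_step[OF t(1,2) elim(2)] D_def using t elim
        by (intro step_towards_minimizer X_in subgradient) (auto simp: alpha lam_pos less_imp_le)
      also have "\<dots> = (1 - 2 / real t) * D w + A / (real t)\<^sup>2
             + 2 / (lam * real t) * ((X t w - xstar) \<bullet> (v t w - h t w))"
        using lam_pos t by (simp add: alpha A_def power_divide power_mult_distrib)
      finally have "s * (norm (X (Suc t) w - xstar))\<^sup>2
             \<le> s * ((1 - 2 / real t) * D w + A / (real t)\<^sup>2
                + 2 / (lam * real t) * ((X t w - xstar) \<bullet> (v t w - h t w)))"
        using s by (rule mult_left_mono)
      then show ?case by (simp add: V_def algebra_simps)
    qed
    show "s * ((1 - 2 / real t) * D w + A / (real t)\<^sup>2) + G\<^sup>2 * (norm (V w))\<^sup>2 / 2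
            \<le> (1 - 1 / (2 * real t)) * (c * real t * D w) + s * A / (real t)\<^sup>2" for w
    proof -
      have V: "G\<^sup>2 * (norm (V w))\<^sup>2 / 2 = 2 * s\<^sup>2 * A / (real t)\<^sup>2 * D w"
        by (simp add: V_def D_def A_def power_mult_distrib power_divide)
      have "s * ((1 - 2 / real t) * D w + A / (real t)\<^sup>2) + G\<^sup>2 * (norm (V w))\<^sup>2 / 2
            = c * D w * ((real t + 1) * (1 - 2 / real t) + 2 * (c * A) * (real t + 1)\<^sup>2 / (real t)\<^sup>2)
              + s * A / (real t)\<^sup>2"
        unfolding V by (simp add: s_def power2_eq_square algebra_simps)
      also have "\<dots> \<le> c * D w * ((1 - 1 / (2 * real t)) * real t) + s * A / (real t)\<^sup>2"
      proof (intro add_right_mono mult_left_mono)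
        have "2 * (c * A) * (real t + 1)\<^sup>2 / (real t)\<^sup>2 \<le> (1 / 2) * (real t + 1)\<^sup>2 / (real t)\<^sup>2"
          using A by (intro divide_right_mono mult_right_mono) auto
        moreover have "(real t + 1) * (1 - 2 / real t) + (1 / 2) * (real t + 1)\<^sup>2 / (real t)\<^sup>2
                \<le> (1 - 1 / (2 * real t)) * real t"
          using t1 by (simp add: field_simps power2_eq_square)
        ultimately show "(real t + 1) * (1 - 2 / real t) + 2 * (c * A) * (real t + 1)\<^sup>2 / (real t)\<^sup>2
            \<le> (1 - 1 / (2 * real t)) * real t" by linarith
      qed (use c in \<open>simp add: D_def\<close>)
      finally show ?thesis by (simp add: mult_ac)
    qed
    show "(\<integral>\<^sup>+ w. ennreal (exp (c * real t * D w)) \<partial>M) \<le> ennreal (exp (4 * c * A))"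
      using Suc.IH t by (simp add: D_def A_def)
    show "V \<in> borel_measurable (H t)" unfolding V_def by measurable
  qed (use t1 in \<open>auto simp: D_def field_simps\<close>)
  also have "(1 - 1 / (2 * real t)) * (4 * c * A) + s * A / (real t)\<^sup>2 \<le> 4 * c * A"
  proof -
    have "(c * A * real t) * (real t + 1) \<le> (c * A * real t) * (2 * real t)"
      using c A t1 by (intro mult_left_mono) auto
    then show ?thesis using t1 by (simp add: s_def field_simps power2_eq_square)
  qed
  finally show ?case
    by (simp add: s_def A_def add.commute)
qed

text \<open>
  \<open>anchor t\<close> is the anchor before step \<open>t\<close>, determined by the iterates before \<open>X t\<close>. It leaves the
  minimizer only in the second half of the run. The fraction in \<open>q\<close> is \<open>weight (Suc t)\<close>.
\<close>
primrec anchor :: "nat \<Rightarrow> 'w \<Rightarrow> 'b" where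
  "anchor 0 w = xstar"
| "anchor (Suc t) w = (if t < T div 2 then xstar else
     let q = 2 * \<alpha> t * (lam * (real T)\<^sup>2 / (real (T - t))\<^sup>2)
     in anchor t w + (q / (1 + q)) *\<^sub>R (X t w - anchor t w))"

definition weight :: "nat \<Rightarrow> real" where
  "weight t = lam * (real T)\<^sup>2 / (real (Suc T - t))\<^sup>2"

definition potential :: "nat \<Rightarrow> 'w \<Rightarrow> real" where
  "potential t w = F (anchor t w) - F xstar + weight t * (norm (X t w - anchor t w))\<^sup>2"

lemma anchor_initial: "t \<le> T div 2 \<Longrightarrow> anchor t w = xstar"
  by (cases t) auto

lemma anchor_adapted:
  assumes "t \<le> T"
  shows "anchor t \<in> borel_measurable (H t)"
  using assms
proof (induction t)
  case 0
  have "anchor 0 = (\<lambda>_. xstar)" by auto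
  then show ?case by simp
next
  case (Suc t)
  show ?case
  proof (cases "t < T div 2 \<or> t = 0")
    case False
    then have [measurable]: "X t \<in> borel_measurable (H (Suc t))"
        "anchor t \<in> borel_measurable (H (Suc t))"
      using Suc by (auto intro!: measurable_history_Suc X_adapted)
    show ?thesis using False by (simp add: Let_def)
  qed (use T_ge in \<open>auto simp: anchor_initial\<close>)
qed

lemma potential_adapted:
  assumes "1 \<le> t" "t \<le> T"
  shows "potential t \<in> borel_measurable (H t)"
proof -
  note [measurable] = X_adapted[OF assms] anchor_adapted[OF assms(2)]
  show ?thesis unfolding potential_def by measurable
qed

lemma weight_pos: "t \<le> T \<Longrightarrow> 0 < weight t"
  using lam_pos T_ge by (simp add: weight_def)

lemma anchor_in:
  assumes "t \<le> T" "w \<in> space M"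
  shows "anchor t w \<in> W"
  using assms(1)
proof (induction t)
  case (Suc t)
  show ?case
  proof (cases "t < T div 2")
    case False
    define q where "q = 2 * \<alpha> t * (lam * (real T)\<^sup>2 / (real (T - t))\<^sup>2)"
    have t: "1 \<le> t" "t < T" using False T_ge Suc.prems by auto
    have "0 \<le> \<alpha> t"
      using step_size_pos[OF t] by simp
    then have q: "0 \<le> q" using lam_pos by (simp add: q_def)
    have "anchor (Suc t) w = (1 - q / (1 + q)) *\<^sub>R anchor t w + (q / (1 + q)) *\<^sub>R X t w"
      using False by (simp add: q_def Let_def algebra_simps)
    also have "\<dots> \<in> W"
      using Suc t q assms(2) by (intro convexD[OF convex_W] X_in) (auto simp: field_simps)
    finally show ?thesis .
  qed (simp add: xstar_in)
qed (simp add: xstar_in)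

lemma potential_step_pathwise:
  assumes t: "T div 2 \<le> t" "1 \<le> t" "t < T" and w: "w \<in> space M"
    and bd: "norm (h t w) \<le> G"
  defines "q \<equiv> 2 * \<alpha> t * weight (Suc t)"
  shows "potential (Suc t) w
     \<le> F (anchor t w) - F xstar + weight (Suc t) / (1 + q)\<^sup>2 * (norm (X t w - anchor t w))\<^sup>2
        + weight (Suc t) * (\<alpha> t)\<^sup>2 * G\<^sup>2
        + ((q / (1 + q)) *\<^sub>R (X t w - anchor t w)) \<bullet> (v t w - h t w)"
proof -
  have u: "0 < weight (Suc t)" using t by (intro weight_pos) auto
  have eq: "anchor (Suc t) w = anchor t w
      + (2 * \<alpha> t * weight (Suc t) / (1 + 2 * \<alpha> t * weight (Suc t))) *\<^sub>R (X t w - anchor t w)"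
    using t by (simp add: weight_def Let_def)
  have W: "X t w \<in> W" "anchor t w \<in> W" using t w by (auto intro: X_in anchor_in)
  show ?thesis
    using potential_step[OF W subgradient[OF t(2,3) w] bd step_size_pos[OF t(2,3)] u, folded eq]
    unfolding potential_def q_def X_step[OF t(2,3) w] by linarith
qed

text \<open>
  At the middle of the run the potential is \<open>weight * D\<close> with a weight of at most \<open>4 * lam\<close>, which
  gives the constant \<open>48\<close>; after that every step adds at most \<open>36 * G\<^sup>2 / (lam * T\<^sup>2)\<close>.
\<close>
lemma exp_moment_potential:
  fixes \<theta> :: real
  assumes \<theta>: "0 \<le> \<theta>" "400 * (\<theta> * G\<^sup>2) \<le> lam * real T" and t: "T div 2 \<le> t" "t \<le> T"
  shows "(\<integral>\<^sup>+ w. ennreal (exp (\<theta> * potential t w)) \<partial>M)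
    \<le> ennreal (exp (\<theta> * ((48 + 36 * real (t - T div 2) / real T) * G\<^sup>2 / (lam * real T))))"
  using t
proof (induction t rule: nat_induct_at_least)
  case base
  define m where "m = T div 2"
  \<comment> \<open>Chosen such that \<open>c * m * D\<close> is \<open>\<theta>\<close> times the upper bound \<open>4 * lam * D\<close> of the potential.\<close>
  define c where "c = 4 * lam * \<theta> / real m"
  have m: "1 \<le> m" "2 * m \<le> T" "T \<le> 3 * m" "m \<le> T" using T_ge by (auto simp: m_def)
  then have m3: "0 < real m" "real T \<le> 3 * real m" by linarith+
  have c: "0 \<le> c" "4 * c * G\<^sup>2 \<le> lam\<^sup>2"
  proof -
    show "0 \<le> c" using lam_pos \<theta> by (simp add: c_def)
    have "16 * (\<theta> * G\<^sup>2) \<le> lam * real m"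
    proof -
      have "lam * real T \<le> lam * (3 * real m)"
        using m3 lam_pos by (intro mult_left_mono) auto
      moreover have "0 \<le> \<theta> * G\<^sup>2" using \<theta> by simp
      ultimately show ?thesis using \<theta>(2) by linarith
    qed
    then have "lam * (16 * (\<theta> * G\<^sup>2)) \<le> lam * (lam * real m)"
      using lam_pos by (intro mult_left_mono) auto
    then show "4 * c * G\<^sup>2 \<le> lam\<^sup>2"
      using m3 by (simp add: c_def field_simps power2_eq_square)
  qed
  have weight: "weight m \<le> 4 * lam"
  proof -
    define r where "r = real (Suc T - m)"
    have r: "0 < r" "real T \<le> 2 * r" using m by (auto simp: r_def of_nat_diff)
    have "(real T)\<^sup>2 \<le> (2 * r)\<^sup>2"
      using r by (intro power_mono) auto
    then have "lam * (real T)\<^sup>2 \<le> lam * (4 * r\<^sup>2)"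
      using lam_pos by (intro mult_left_mono) (auto simp: power_mult_distrib)
    then show ?thesis
      using r by (simp add: weight_def r_def[symmetric] divide_simps mult_ac)
  qed
  have "(\<integral>\<^sup>+ w. ennreal (exp (\<theta> * potential m w)) \<partial>M)
      \<le> (\<integral>\<^sup>+ w. ennreal (exp (c * real m * (norm (X m w - xstar))\<^sup>2)) \<partial>M)"
  proof (intro nn_integral_mono ennreal_leI, unfold exp_le_cancel_iff)
    fix w
    have "\<theta> * (weight m * (norm (X m w - xstar))\<^sup>2) \<le> \<theta> * (4 * lam * (norm (X m w - xstar))\<^sup>2)"
      using weight \<theta> by (intro mult_left_mono mult_right_mono) auto
    then show "\<theta> * potential m w \<le> c * real m * (norm (X m w - xstar))\<^sup>2"
      using m3 by (simp add: potential_def anchor_initial m_def[symmetric] c_def mult_ac)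
  qed
  also have "\<dots> \<le> ennreal (exp (4 * c * G\<^sup>2 / lam\<^sup>2))"
    by (intro exp_moment_distance c m)
  also have "4 * c * G\<^sup>2 / lam\<^sup>2 \<le> \<theta> * (48 * G\<^sup>2 / (lam * real T))"
  proof -
    have "16 * \<theta> * G\<^sup>2 / lam * (1 / real m) \<le> 16 * \<theta> * G\<^sup>2 / lam * (3 / real T)"
      using m3 T_ge \<theta> lam_pos by (intro mult_left_mono) (auto simp: field_simps)
    then show ?thesis
      using lam_pos by (simp add: c_def power2_eq_square mult_ac)
  qed
  finally show ?case by (simp add: m_def)
next
  case (Suc t)
  have t: "T div 2 \<le> t" "1 \<le> t" "t < T" using Suc T_ge by auto
  define r where "r = real (T - t)"
  define u where "u = lam * (real T)\<^sup>2 / r\<^sup>2"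
  define q where "q = 2 * \<alpha> t * u"
  define z where "z = anchor t"
  define c where "c = 36 * G\<^sup>2 / (lam * (real T)\<^sup>2)"
  define V where "V w = (\<theta> * (q / (1 + q))) *\<^sub>R (X t w - z w)" for w
  obtain \<kappa> where \<kappa>: "\<alpha> t = \<kappa> / (lam * real t)" "r / real T < \<kappa>" "\<kappa> \<le> 2 * r / real T"
    using step_factor[OF t(2,3)] unfolding r_def by blast
  have u: "weight (Suc t) = u" by (simp add: weight_def u_def r_def)
  have r1: "weight t = lam * (real T)\<^sup>2 / (r + 1)\<^sup>2"
    using t by (simp add: weight_def r_def of_nat_diff Suc_diff_le)
  have rt: "1 \<le> r" "r + real t = real T" "real T \<le> 3 * real t"
    using t by (auto simp: r_def of_nat_diff)
  have \<theta>G: "0 \<le> \<theta> * G\<^sup>2" using \<theta> by simp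
  have q_eq: "q = 2 * (\<kappa> / (lam * real t)) * (lam * (real T)\<^sup>2 / r\<^sup>2)"
    by (simp add: q_def u_def \<kappa>)
  have slack: "u / (1 + q)\<^sup>2 + \<theta> * G\<^sup>2 * (q / (1 + q))\<^sup>2 / 2 \<le> weight t"
    "u * (\<alpha> t)\<^sup>2 \<le> 36 / (lam * (real T)\<^sup>2)"
    using weight_recursion[OF rt lam_pos \<kappa>(2,3) \<theta>G \<theta>(2)]
    unfolding q_eq u_def \<kappa>(1) r1 by (simp_all add: mult.assoc)
  have uc: "u * (\<alpha> t)\<^sup>2 * G\<^sup>2 \<le> c"
    using mult_right_mono[OF slack(2), of "G\<^sup>2"] by (simp add: c_def)
  have [measurable]: "X t \<in> borel_measurable (H t)" "z \<in> borel_measurable (H t)"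
    using t by (auto intro!: X_adapted anchor_adapted simp: z_def)
  define b where "b = \<theta> * ((48 + 36 * real (t - T div 2) / real T) * G\<^sup>2 / (lam * real T))"
  have "(\<integral>\<^sup>+ w. ennreal (exp (\<theta> * potential (Suc t) w)) \<partial>M) \<le> ennreal (exp (1 * b + \<theta> * c))"
  proof (rule exp_moment_step[OF t(2,3), where V = V and U = "\<lambda>w. \<theta> * potential t w"
        and Y = "\<lambda>w. \<theta> * (F (z w) - F xstar + u / (1 + q)\<^sup>2 * (norm (X t w - z w))\<^sup>2 + c)"])
    show "AE w in M. \<theta> * potential (Suc t) w
      \<le> \<theta> * (F (z w) - F xstar + u / (1 + q)\<^sup>2 * (norm (X t w - z w))\<^sup>2 + c)
         + V w \<bullet> (v t w - h t w)"
      using estimate_bound[OF t(2,3)] AE_space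
    proof eventually_elim
      case (elim w)
      have "potential (Suc t) w
        \<le> F (z w) - F xstar + u / (1 + q)\<^sup>2 * (norm (X t w - z w))\<^sup>2 + c
          + ((q / (1 + q)) *\<^sub>R (X t w - z w)) \<bullet> (v t w - h t w)"
        using potential_step_pathwise[OF t elim(2,1)] uc unfolding u q_def z_def by linarith
      then have "\<theta> * potential (Suc t) w
        \<le> \<theta> * (F (z w) - F xstar + u / (1 + q)\<^sup>2 * (norm (X t w - z w))\<^sup>2 + c
          + ((q / (1 + q)) *\<^sub>R (X t w - z w)) \<bullet> (v t w - h t w))"
        using \<theta>(1) by (rule mult_left_mono)
      then show ?case by (simp add: V_def distrib_left mult.assoc)
    qed
    show "\<theta> * (F (z w) - F xstar + u / (1 + q)\<^sup>2 * (norm (X t w - z w))\<^sup>2 + c)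
            + G\<^sup>2 * (norm (V w))\<^sup>2 / 2 \<le> 1 * (\<theta> * potential t w) + \<theta> * c" for w
    proof -
      define d where "d = (norm (X t w - z w))\<^sup>2"
      have "G\<^sup>2 * (norm (V w))\<^sup>2 / 2 = \<theta> * (\<theta> * G\<^sup>2 * (q / (1 + q))\<^sup>2 / 2 * d)"
        by (simp add: V_def d_def power_mult_distrib power2_eq_square)
      then have "\<theta> * (F (z w) - F xstar + u / (1 + q)\<^sup>2 * d + c) + G\<^sup>2 * (norm (V w))\<^sup>2 / 2
           = \<theta> * (F (z w) - F xstar + (u / (1 + q)\<^sup>2 + \<theta> * G\<^sup>2 * (q / (1 + q))\<^sup>2 / 2) * d + c)"
        by (simp add: algebra_simps)
      also have "\<dots> \<le> \<theta> * (F (z w) - F xstar + weight t * d + c)"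
        using \<theta> slack(1) by (intro mult_left_mono add_left_mono add_right_mono mult_right_mono)
          (auto simp: d_def)
      finally show ?thesis by (simp add: potential_def z_def d_def distrib_left)
    qed
    show "(\<integral>\<^sup>+ w. ennreal (exp (\<theta> * potential t w)) \<partial>M) \<le> ennreal (exp b)"
      using Suc.IH t by (simp add: b_def)
    show "(\<lambda>w. \<theta> * potential t w) \<in> borel_measurable (H t)"
      using potential_adapted[of t] t by auto
    show "V \<in> borel_measurable (H t)" unfolding V_def by measurable
  qed auto
  also have "1 * b + \<theta> * c
      = \<theta> * ((48 + 36 * real (Suc t - T div 2) / real T) * G\<^sup>2 / (lam * real T))"
    using t lam_pos by (simp add: b_def c_def Suc_diff_le field_simps power2_eq_square)
  finally show ?case .
qed

text \<open>
  Passing from the anchor to the iterate at distance \<open>d\<close> costs \<open>G * d\<close>. Completing the square, this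
  exceeds the term \<open>lam * T\<^sup>2 * d\<^sup>2\<close> of the potential by at most \<open>G\<^sup>2 / (4 * lam * T\<^sup>2)\<close>. The second half has at most \<open>2 * T / 3\<close> steps, so the constants add up to \<open>48 + 24 + 1\<close>.
\<close>
theorem exp_moment_last_iterate:
  assumes \<theta>: "0 \<le> \<theta>" "400 * (\<theta> * G\<^sup>2) \<le> lam * real T"
  shows "(\<integral>\<^sup>+ w. ennreal (exp (\<theta> * (F (X T w) - (F xstar + 73 * G\<^sup>2 / (lam * real T))))) \<partial>M) \<le> 1"
proof -
  define B where "B = G\<^sup>2 / (lam * real T)"
  have T: "1 \<le> T" "1 \<le> real T" using T_ge by auto
  have B: "0 \<le> B" using lam_pos by (simp add: B_def)
  have pot: "F (X T w) - (F xstar + 73 * B) \<le> potential T w - 72 * B" if w: "w \<in> space M" for w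
  proof -
    define d where "d = norm (X T w - anchor T w)"
    define k where "k = lam * (real T)\<^sup>2"
    have k: "0 < k" using lam_pos T by (simp add: k_def)
    have "F (X T w) - F (anchor T w) \<le> G * d"
      unfolding d_def using T w by (intro gap_le_distance X_in) auto
    moreover have "G * d \<le> k * d\<^sup>2 + G\<^sup>2 / (4 * k)"
    proof -
      have "0 \<le> (2 * k * d - G)\<^sup>2 / (4 * k)" using k by simp
      also have "\<dots> = k * d\<^sup>2 + G\<^sup>2 / (4 * k) - G * d"
        using k by (simp add: power2_eq_square field_simps)
      finally show ?thesis by simp
    qed
    moreover have "G\<^sup>2 / (4 * k) \<le> B"
    proof -
      have "lam * real T * 1 \<le> lam * real T * (4 * real T)"
        using T lam_pos by (intro mult_left_mono) auto
      then have "lam * real T \<le> 4 * k"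
        by (simp add: k_def power2_eq_square)
      then show ?thesis
        unfolding B_def using lam_pos T k by (intro divide_left_mono) auto
    qed
    moreover have "potential T w = F (anchor T w) - F xstar + k * d\<^sup>2"
      by (simp add: potential_def weight_def d_def k_def)
    ultimately show ?thesis by linarith
  qed
  note [measurable] = potential_adapted[OF T(1) order_refl, THEN measurable_history]
  have "(\<integral>\<^sup>+ w. ennreal (exp (\<theta> * (F (X T w) - (F xstar + 73 * B)))) \<partial>M)
      \<le> (\<integral>\<^sup>+ w. ennreal (exp (- (\<theta> * (72 * B)))) * ennreal (exp (\<theta> * potential T w)) \<partial>M)"
  proof (intro nn_integral_mono)
    fix w assume "w \<in> space M"
    from mult_left_mono[OF pot[OF this] \<theta>(1)]
    show "ennreal (exp (\<theta> * (F (X T w) - (F xstar + 73 * B))))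
        \<le> ennreal (exp (- (\<theta> * (72 * B)))) * ennreal (exp (\<theta> * potential T w))"
      by (simp add: right_diff_distrib flip: ennreal_mult' exp_add)
  qed
  also have "\<dots> = ennreal (exp (- (\<theta> * (72 * B)))) * (\<integral>\<^sup>+ w. ennreal (exp (\<theta> * potential T w)) \<partial>M)"
    by (simp add: nn_integral_cmult)
  also have "\<dots> \<le> ennreal (exp (- (\<theta> * (72 * B)))) * ennreal (exp (\<theta> * (72 * B)))"
  proof (intro mult_left_mono)
    have "3 * (T - T div 2) \<le> 2 * T" using T_ge by linarith
    then have "3 * real (T - T div 2) \<le> 2 * real T" by linarith
    then have "48 + 36 * real (T - T div 2) / real T \<le> 72"
      using T by (simp add: field_simps)
    then have "(48 + 36 * real (T - T div 2) / real T) * B \<le> 72 * B"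
      using B by (rule mult_right_mono)
    then have "\<theta> * ((48 + 36 * real (T - T div 2) / real T) * B) \<le> \<theta> * (72 * B)"
      using \<theta>(1) by (rule mult_left_mono)
    then have "ennreal (exp (\<theta> * ((48 + 36 * real (T - T div 2) / real T) * B)))
        \<le> ennreal (exp (\<theta> * (72 * B)))" by (intro ennreal_leI) simp
    then show "(\<integral>\<^sup>+ w. ennreal (exp (\<theta> * potential T w)) \<partial>M) \<le> ennreal (exp (\<theta> * (72 * B)))"
      using exp_moment_potential[OF \<theta>, of T]
      unfolding B_def times_divide_eq_right by (rule order_trans[rotated]) simp_all
  qed simp
  also have "\<dots> = 1" by (simp flip: ennreal_mult' exp_add)
  finally show ?thesis by (simp add: B_def)
qed

lemma last_value_measurable: "(\<lambda>w. F (X T w)) \<in> borel_measurable M"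
proof -
  have T: "1 \<le> T" using T_ge by simp
  note [measurable] = X_adapted[OF T order_refl, THEN measurable_history]
  show ?thesis by measurable
qed

lemma integrable_last_value: "integrable M (\<lambda>w. F (X T w))"
proof (rule integrable_const_bound)
  have "norm (F (X T w)) \<le> \<bar>F xstar\<bar> + G\<^sup>2 / lam" if "w \<in> space M" for w
  proof -
    have "X T w \<in> W" using that T_ge by (intro X_in) auto
    from gap_le[OF this] gap_nonneg[of "X T w"] show ?thesis by (simp add: abs_if)
  qed
  then show "AE w in M. norm (F (X T w)) \<le> \<bar>F xstar\<bar> + G\<^sup>2 / lam" by (intro AE_I2)
qed (rule last_value_measurable)

theorem expectation_last_value:
  "expectation (\<lambda>w. F (X T w)) \<le> F xstar + 73 * G\<^sup>2 / (lam * real T)"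
proof (rule expectation_le_if_exp_moment[OF integrable_last_value])
  \<comment> \<open>Any admissible positive \<open>\<theta>\<close> gives the same bound; the summand \<open>1\<close> covers \<open>G = 0\<close>.\<close>
  define K where "K = G\<^sup>2 + 1"
  define \<theta> where "\<theta> = lam * real T / (400 * K)"
  have K: "0 < K" unfolding K_def by (smt (verit) zero_le_power2)
  then show \<theta>: "0 < \<theta>" using lam_pos T_ge by (simp add: \<theta>_def)
  have "400 * (\<theta> * K) = lam * real T" using K by (simp add: \<theta>_def)
  then have "400 * (\<theta> * G\<^sup>2) \<le> lam * real T" using \<theta> by (simp add: K_def distrib_left)
  then show "(\<integral>\<^sup>+ w. ennreal (exp (\<theta> * (F (X T w) - (F xstar + 73 * G\<^sup>2 / (lam * real T))))) \<partial>M) \<le> 1"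
    using \<theta> by (intro exp_moment_last_iterate) auto
qed

theorem high_probability_last_value:
  assumes L: "1 \<le> L"
  shows "1 - exp (- L)
    \<le> prob {w \<in> space M. F (X T w) \<le> F xstar + 473 * (G\<^sup>2 * L / (lam * real T))}"
proof (cases "G = 0")
  case True
  have "{w \<in> space M. F (X T w) \<le> F xstar + 473 * (G\<^sup>2 * L / (lam * real T))} = space M"
    using gap_le[OF X_in[of T]] T_ge by (auto simp: True)
  then show ?thesis by (simp add: prob_space)
next
  case False
  define B where "B = G\<^sup>2 / (lam * real T)"
  define \<theta> where "\<theta> = lam * real T / (400 * G\<^sup>2)"
  have G2: "0 < G\<^sup>2" using False by simp
  have \<theta>: "0 < \<theta>" "400 * (\<theta> * G\<^sup>2) \<le> lam * real T"
    using G2 lam_pos T_ge by (auto simp: \<theta>_def)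
  have B: "0 \<le> B" using lam_pos by (simp add: B_def)
  note [measurable] = last_value_measurable
  have "1 - exp (- L) \<le> prob {w \<in> space M. F (X T w) \<le> (F xstar + 73 * G\<^sup>2 / (lam * real T)) + L / \<theta>}"
    using \<theta> by (intro prob_le_if_exp_moment last_value_measurable exp_moment_last_iterate) auto
  also have "\<dots> \<le> prob {w \<in> space M. F (X T w) \<le> F xstar + 473 * (G\<^sup>2 * L / (lam * real T))}"
  proof (intro finite_measure_mono Collect_mono conj_mono imp_refl impI)
    fix w
    assume le: "F (X T w) \<le> (F xstar + 73 * G\<^sup>2 / (lam * real T)) + L / \<theta>"
    have "L / \<theta> = 400 * (L * B)" by (simp add: \<theta>_def B_def)
    moreover have "1 * B \<le> L * B" using L B by (rule mult_right_mono)
    moreover have "F (X T w) \<le> F xstar + 73 * B + L / \<theta>"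
      using le by (simp add: B_def)
    ultimately have "F (X T w) \<le> F xstar + 473 * (L * B)" by linarith
    then show "F (X T w) \<le> F xstar + 473 * (G\<^sup>2 * L / (lam * real T))"
      by (simp add: B_def mult_ac)
  qed measurable
  finally show ?thesis .
qed

end

section \<open>Stochastic and deterministic runs\<close>

text \<open>
  Hoeffding's lemma: \<open>V \<bullet> Y\<close> ranges over an interval of length \<open>2 * G * norm V\<close>.
\<close>
lemma (in prob_space) exp_moment_centred_inner:
  fixes Y :: "'a \<Rightarrow> 'b::euclidean_space"
  assumes Y: "integrable M Y" and bound: "AE w in M. norm (Y w) \<le> G"
  shows "(\<integral>\<^sup>+ w. ennreal (exp (V \<bullet> (expectation Y - Y w))) \<partial>M)
           \<le> ennreal (exp (G\<^sup>2 * (norm V)\<^sup>2 / 2))"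
proof -
  note [measurable] = borel_measurable_integrable[OF Y]
  have "AE w in M. - (V \<bullet> Y w) \<in> {- (norm V * G) .. norm V * G}"
    using bound
  proof eventually_elim
    case (elim w)
    have "\<bar>V \<bullet> Y w\<bar> \<le> norm V * norm (Y w)" by (rule Cauchy_Schwarz_ineq2)
    also have "\<dots> \<le> norm V * G" using elim by (intro mult_left_mono) auto
    finally show ?case by auto
  qed
  then interpret Z: interval_bounded_random_variable M "\<lambda>w. - (V \<bullet> Y w)" "- (norm V * G)" "norm V * G"
    by unfold_locales measurable
  have "expectation (\<lambda>w. - (V \<bullet> Y w)) = - (V \<bullet> expectation Y)"
    using Y by (simp add: integral_inner_right)
  then have "(\<integral>\<^sup>+ w. ennreal (exp (V \<bullet> (expectation Y - Y w))) \<partial>M)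
      = (\<integral>\<^sup>+ w. ennreal (exp (1 * (- (V \<bullet> Y w) - expectation (\<lambda>w. - (V \<bullet> Y w))))) \<partial>M)"
    by (simp add: inner_diff_right)
  also have "\<dots> \<le> ennreal (exp (1\<^sup>2 * (norm V * G - - (norm V * G))\<^sup>2 / 8))"
    by (rule Z.Hoeffdings_lemma_nn_integral) simp
  also have "1\<^sup>2 * (norm V * G - - (norm V * G))\<^sup>2 / 8 = G\<^sup>2 * (norm V)\<^sup>2 / 2"
    by (simp add: power2_eq_square)
  finally show ?thesis .
qed

text \<open>
  Independence of two sub-sigma-algebras means that the pair of identity maps into them has a product
  law. Fubini's theorem then allows a fresh copy of the sample point in every quantity that is
  determined by the second one, jointly with a point determined by the first one.
\<close>
lemma (in prob_space) nn_integral_decouple: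
  fixes \<Phi> :: "'a \<Rightarrow> 'a \<Rightarrow> ennreal"
  assumes B: "subalgebra M B" and A: "subalgebra M A"
    and indep: "indep_set (sets B) (sets A)"
    and meas: "(\<lambda>(w, w'). \<Phi> w w') \<in> borel_measurable (B \<Otimes>\<^sub>M A)"
  shows "(\<integral>\<^sup>+ w. \<Phi> w w \<partial>M) = (\<integral>\<^sup>+ w. \<integral>\<^sup>+ w'. \<Phi> w w' \<partial>M \<partial>M)"
proof -
  have id_B: "(\<lambda>w. w) \<in> measurable M B" and id_A: "(\<lambda>w. w) \<in> measurable M A"
    by (rule measurable_from_subalg[OF B], simp, rule measurable_from_subalg[OF A], simp)
  have gen: "sigma_sets (space M) {(\<lambda>w. w) -` S \<inter> space M | S. S \<in> sets N} = sets N"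
    if "subalgebra M N" for N
  proof -
    have "{(\<lambda>w. w) -` S \<inter> space M | S. S \<in> sets N} = sets N"
      using that sets.sets_into_space[of _ N] by (auto simp: subalgebra_def Int_absorb2)
    then show ?thesis
      using that sets.sigma_sets_eq[of N] by (simp add: subalgebra_def)
  qed
  have "indep_var B (\<lambda>w. w) A (\<lambda>w. w)"
    unfolding indep_var_eq gen[OF B] gen[OF A] using id_A id_B indep by simp
  then have law: "distr M B (\<lambda>w. w) \<Otimes>\<^sub>M distr M A (\<lambda>w. w) = distr M (B \<Otimes>\<^sub>M A) (\<lambda>w. (w, w))"
    unfolding indep_var_distribution_eq by simp
  interpret A': prob_space "distr M A (\<lambda>w. w)" by (rule prob_space_distr[OF id_A])
  have m1: "\<Phi> w \<in> borel_measurable A" if "w \<in> space B" for w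
    using measurable_compose[OF measurable_Pair1'[OF that] meas] by simp
  have m2: "(\<lambda>w. \<integral>\<^sup>+ w'. \<Phi> w w' \<partial>distr M A (\<lambda>w. w)) \<in> borel_measurable B"
    using meas by (intro A'.borel_measurable_nn_integral) (simp cong: measurable_cong_sets)
  have "(\<integral>\<^sup>+ w. \<Phi> w w \<partial>M) = (\<integral>\<^sup>+ p. (case p of (w, w') \<Rightarrow> \<Phi> w w') \<partial>distr M (B \<Otimes>\<^sub>M A) (\<lambda>w. (w, w)))"
    using meas id_A id_B by (subst nn_integral_distr) auto
  also have "\<dots> = (\<integral>\<^sup>+ w. \<integral>\<^sup>+ w'. \<Phi> w w' \<partial>distr M A (\<lambda>w. w) \<partial>distr M B (\<lambda>w. w))"
    unfolding law[symmetric] using meas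
    by (subst A'.nn_integral_fst[symmetric]) (auto cong: measurable_cong_sets)
  also have "\<dots> = (\<integral>\<^sup>+ w. \<integral>\<^sup>+ w'. \<Phi> w w' \<partial>distr M A (\<lambda>w. w) \<partial>M)"
    using m2 id_B by (subst nn_integral_distr) auto
  also have "\<dots> = (\<integral>\<^sup>+ w. \<integral>\<^sup>+ w'. \<Phi> w w' \<partial>M \<partial>M)"
    using m1 B id_A by (intro nn_integral_cong, subst nn_integral_distr) (auto simp: subalgebra_def)
  finally show ?thesis .
qed

lemma (in prob_space) indep_past_present:
  assumes indep: "indep_sets (\<lambda>t. sets (A t)) {1..}"
    and sub: "\<And>t. 1 \<le> t \<Longrightarrow> subalgebra M (A t)" and t: "1 \<le> (t::nat)"
  shows "indep_set (sigma_sets (space M) (\<Union>s\<in>{1..<t}. sets (A s))) (sets (A t))"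
proof -
  let ?I = "case_bool {1..<t} {t}"
  have "indep_sets (\<lambda>j. sigma_sets (space M) (\<Union>i\<in>?I j. sets (A i))) UNIV"
  proof (rule indep_sets_collect_sigma)
    show "indep_sets (\<lambda>t. sets (A t)) (\<Union>j\<in>UNIV. ?I j)"
      using t by (intro indep_sets_mono_index[OF _ indep]) (auto simp: UNIV_bool)
    show "disjoint_family_on ?I UNIV"
      by (auto simp: disjoint_family_on_def split: bool.splits)
  qed (auto simp: Int_stable_def)
  moreover have "sigma_sets (space M) (sets (A t)) = sets (A t)"
    using sub[OF t] sets.sigma_sets_eq[of "A t"] by (simp add: subalgebra_def)
  ultimately show ?thesis
    unfolding indep_set_def
    by (elim indep_sets_mono_sets) (auto split: bool.splits)
qed

text \<open>
  The history before step \<open>t\<close> is generated by the sigma-algebras that carry the earlier random maps.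
  Decoupling it from the map at time \<open>t\<close> freezes the iterate, so that the assumptions about the map at
  fixed points apply: the almost sure bound, although its exceptional set depends on the point, and
  Hoeffding's lemma.
\<close>
lemma (in lipschitz_strongly_convex) sgd_noisy_subgradient_run:
  fixes M :: "'w measure" and ghat :: "nat \<Rightarrow> 'w \<Rightarrow> 'b \<Rightarrow> 'b" and g :: "nat \<Rightarrow> 'b \<Rightarrow> 'b"
    and X :: "nat \<Rightarrow> 'w \<Rightarrow> 'b"
  assumes M: "prob_space M"
    and maps: "prob_space.indep_random_maps M W ghat {1..}"
    and int: "\<And>t x. t \<ge> 1 \<Longrightarrow> x \<in> W \<Longrightarrow> integrable M (\<lambda>w. ghat t w x)"
    and mean: "\<And>t x. t \<ge> 1 \<Longrightarrow> x \<in> W \<Longrightarrow> prob_space.expectation M (\<lambda>w. ghat t w x) = g t x"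
    and sub: "\<And>t x. t \<ge> 1 \<Longrightarrow> x \<in> W \<Longrightarrow> g t x \<in> subdifferential F x"
    and bound: "\<And>t x. t \<ge> 1 \<Longrightarrow> x \<in> W \<Longrightarrow> AE w in M. norm (ghat t w x) \<le> G"
    and T: "2 \<le> T"
    and steps: "halving_steps lam T \<alpha>"
    and x1: "x1 \<in> W"
    and X1: "\<And>w. w \<in> space M \<Longrightarrow> X 1 w = x1"
    and XS: "\<And>t w. 1 \<le> t \<Longrightarrow> t < T \<Longrightarrow> w \<in> space M \<Longrightarrow>
           X (t + 1) w = closest_point W (X t w - \<alpha> t *\<^sub>R ghat t w (X t w))"
  shows "\<exists>H. noisy_subgradient_run W F xstar G lam M T \<alpha> H X
           (\<lambda>t w. g t (X t w)) (\<lambda>t w. ghat t w (X t w))"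
proof -
  interpret prob_space M by (rule M)
  obtain A where indep: "indep_sets (\<lambda>t. sets (A t)) {1..}"
    and A: "\<And>t. 1 \<le> t \<Longrightarrow> subalgebra M (A t)"
    and J: "\<And>t. 1 \<le> t \<Longrightarrow>
      (\<lambda>(x, w). ghat t w x) \<in> borel_measurable (restrict_space borel W \<Otimes>\<^sub>M A t)"
    using maps unfolding indep_random_maps_def by auto
  define H where "H t = sigma (space M) (\<Union>s\<in>{1..<t}. sets (A s))" for t
  have gen: "(\<Union>s\<in>{1..<t}. sets (A s)) \<subseteq> Pow (space M)" for t
    using A sets.sets_into_space by (fastforce simp: subalgebra_def)
  have space_H: "space (H t) = space M" for t
    using gen by (simp add: H_def)
  have sets_H: "sets (H t) = sigma_sets (space M) (\<Union>s\<in>{1..<t}. sets (A s))" for t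
    using gen by (simp add: H_def)
  have H: "subalgebra M (H t)" for t
    unfolding subalgebra_def space_H sets_H
    by (intro conjI refl sets.sigma_sets_subset) (use A in \<open>fastforce simp: subalgebra_def\<close>)
  have H_Suc: "subalgebra (H (Suc t)) (H t)" for t
    unfolding subalgebra_def space_H sets_H by (intro conjI refl sigma_sets_mono' UN_mono) auto
  have H_A: "subalgebra (H (Suc t)) (A t)" if "1 \<le> t" for t
    using A[OF that] that unfolding subalgebra_def space_H sets_H
    by (auto intro!: sigma_sets.Basic bexI[of _ t])
  have fresh: "indep_set (sets (H t)) (sets (A t))" if "1 \<le> t" for t
    unfolding sets_H using indep A that by (rule indep_past_present)
  have X_in: "X t w \<in> W" if "1 \<le> t" "t \<le> T" "w \<in> space M" for t w
    using that
  proof (induction t rule: nat_induct_at_least)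
    case base
    then show ?case using X1 x1 by simp
  next
    case (Suc t)
    then show ?case using XS[of t w] projection_in by simp
  qed
  have X_W: "X t \<in> measurable (H t) (restrict_space borel W)"
    if "X t \<in> borel_measurable (H t)" "1 \<le> t" "t \<le> T" for t
    using that X_in by (intro measurable_restrict_space2) (auto simp: space_H)
  have X_meas: "X t \<in> borel_measurable (H t)" if "1 \<le> t" "t \<le> T" for t
    using that
  proof (induction t rule: nat_induct_at_least)
    case base
    have "X 1 \<in> borel_measurable (H 1) \<longleftrightarrow> (\<lambda>_. x1) \<in> borel_measurable (H 1)"
      by (intro measurable_cong) (simp add: space_H X1[simplified])
    then show ?case by simp
  next
    case (Suc t)
    then have t: "1 \<le> t" "t < T" by auto
    have 1: "X t \<in> measurable (H (Suc t)) (restrict_space borel W)"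
      using Suc t by (intro measurable_from_subalg[OF H_Suc] X_W) auto
    have 2: "(\<lambda>w. w) \<in> measurable (H (Suc t)) (A t)"
      by (rule measurable_from_subalg[OF H_A[OF t(1)]]) simp
    have 3: "(\<lambda>w. ghat t w (X t w)) \<in> borel_measurable (H (Suc t))"
      using measurable_compose[OF measurable_Pair[OF 1 2] J[OF t(1)]] by simp
    have 4: "X t \<in> borel_measurable (H (Suc t))"
      using Suc t by (intro measurable_from_subalg[OF H_Suc]) auto
    have 5: "closest_point W \<in> borel_measurable borel"
      using closed_W convex_W xstar_in
      by (intro borel_measurable_continuous_onI continuous_on_closest_point) auto
    have "(\<lambda>w. closest_point W (X t w - \<alpha> t *\<^sub>R ghat t w (X t w))) \<in> borel_measurable (H (Suc t))"
      using 3 4 by (intro measurable_compose[OF _ 5]) simp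
    moreover have "X (Suc t) \<in> borel_measurable (H (Suc t)) \<longleftrightarrow>
      (\<lambda>w. closest_point W (X t w - \<alpha> t *\<^sub>R ghat t w (X t w))) \<in> borel_measurable (H (Suc t))"
      using XS[OF t] by (intro measurable_cong) (simp add: space_H)
    ultimately show ?case by simp
  qed
  have estimate: "(\<lambda>(w, w'). ghat t w' (X t w)) \<in> borel_measurable (H t \<Otimes>\<^sub>M A t)"
    if t: "1 \<le> t" "t < T" for t
  proof -
    have "X t \<in> measurable (H t) (restrict_space borel W)"
      using t by (intro X_W X_meas) auto
    then have "(\<lambda>p. (X t (fst p), snd p)) \<in> measurable (H t \<Otimes>\<^sub>M A t) (restrict_space borel W \<Otimes>\<^sub>M A t)"
      by measurable
    from measurable_compose[OF this J[OF t(1)]] show ?thesis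
      by (simp add: case_prod_beta')
  qed
  have mean_meas: "(\<lambda>w. g t (X t w)) \<in> borel_measurable (H t)" if t: "1 \<le> t" "t < T" for t
  proof -
    have "(\<lambda>p. (fst p, snd p)) \<in> measurable (H t \<Otimes>\<^sub>M M) (H t \<Otimes>\<^sub>M A t)"
      by (intro measurable_Pair measurable_fst)
        (rule measurable_compose[OF measurable_snd], rule measurable_from_subalg[OF A[OF t(1)]], simp)
    from measurable_compose[OF this estimate[OF t]]
    have "(\<lambda>(w, w'). ghat t w' (X t w)) \<in> borel_measurable (H t \<Otimes>\<^sub>M M)"
      by (simp add: case_prod_beta')
    then have "(\<lambda>w. \<integral>w'. ghat t w' (X t w) \<partial>M) \<in> borel_measurable (H t)"
      by (rule borel_measurable_lebesgue_integral)
    moreover have "(\<lambda>w. \<integral>w'. ghat t w' (X t w) \<partial>M) \<in> borel_measurable (H t)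
        \<longleftrightarrow> (\<lambda>w. g t (X t w)) \<in> borel_measurable (H t)"
      using t by (intro measurable_cong) (auto simp: space_H intro!: mean X_in)
    ultimately show ?thesis by simp
  qed
  have "noisy_subgradient_run W F xstar G lam M T \<alpha> H X
           (\<lambda>t w. g t (X t w)) (\<lambda>t w. ghat t w (X t w))"
  proof (unfold_locales)
    fix t assume t: "1 \<le> t" "t < T"
    define bad where "bad w w' = (indicator {y. G < norm y} (ghat t w' (X t w)) :: ennreal)" for w w'
    have bad_meas: "(\<lambda>(w, w'). bad w w') \<in> borel_measurable (H t \<Otimes>\<^sub>M A t)"
      unfolding bad_def using measurable_compose[OF estimate[OF t], of "indicator {y. G < norm y}" borel]
      by (simp add: case_prod_beta')
    have "(\<integral>\<^sup>+ w. bad w w \<partial>M) = (\<integral>\<^sup>+ w. \<integral>\<^sup>+ w'. bad w w' \<partial>M \<partial>M)"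
      by (rule nn_integral_decouple[OF H A[OF t(1)] fresh[OF t(1)] bad_meas])
    also have "\<dots> = (\<integral>\<^sup>+ w. 0 \<partial>M)"
    proof (rule nn_integral_cong)
      fix w assume "w \<in> space M"
      then have "AE w' in M. norm (ghat t w' (X t w)) \<le> G"
        using t by (intro bound X_in) auto
      then have "AE w' in M. bad w w' = 0"
        by eventually_elim (simp add: bad_def)
      then have "(\<integral>\<^sup>+ w'. bad w w' \<partial>M) = (\<integral>\<^sup>+ w'. 0 \<partial>M)"
        by (rule nn_integral_cong_AE)
      then show "(\<integral>\<^sup>+ w'. bad w w' \<partial>M) = 0" by simp
    qed
    finally have "(\<integral>\<^sup>+ w. bad w w \<partial>M) = 0" by simp
    moreover have "(\<lambda>w. bad w w) \<in> borel_measurable M"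
    proof -
      have "(\<lambda>w. (w, w)) \<in> measurable M (H t \<Otimes>\<^sub>M A t)"
        by (rule measurable_Pair)
          (rule measurable_from_subalg[OF H[of t]], simp, rule measurable_from_subalg[OF A[OF t(1)]], simp)
      from measurable_compose[OF this bad_meas] show ?thesis by simp
    qed
    ultimately have "AE w in M. bad w w = 0" by (simp add: nn_integral_0_iff_AE)
    then show "AE w in M. norm (ghat t w (X t w)) \<le> G"
      by eventually_elim (simp add: bad_def indicator_def split: if_splits)
  next
    fix t and Z :: "'w \<Rightarrow> ennreal" and V :: "'w \<Rightarrow> 'b"
    assume t: "1 \<le> t" "t < T" and [measurable]: "Z \<in> borel_measurable (H t)" "V \<in> borel_measurable (H t)"
    note [measurable] = mean_meas[OF t]
    have "(\<lambda>p. ghat t (snd p) (X t (fst p))) \<in> borel_measurable (H t \<Otimes>\<^sub>M A t)"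
      using estimate[OF t] by (simp add: case_prod_beta')
    note [measurable] = this
    have "(\<lambda>p. Z (fst p) * ennreal (exp (V (fst p) \<bullet> (g t (X t (fst p)) - ghat t (snd p) (X t (fst p))))))
        \<in> borel_measurable (H t \<Otimes>\<^sub>M A t)"
      by measurable
    then have "(\<integral>\<^sup>+ w. Z w * ennreal (exp (V w \<bullet> (g t (X t w) - ghat t w (X t w)))) \<partial>M)
       = (\<integral>\<^sup>+ w. \<integral>\<^sup>+ w'. Z w * ennreal (exp (V w \<bullet> (g t (X t w) - ghat t w' (X t w)))) \<partial>M \<partial>M)"
      by (intro nn_integral_decouple[OF H A[OF t(1)] fresh[OF t(1)]]) (simp add: case_prod_beta')
    also have "\<dots> \<le> (\<integral>\<^sup>+ w. Z w * ennreal (exp (G\<^sup>2 * (norm (V w))\<^sup>2 / 2)) \<partial>M)"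
    proof (rule nn_integral_mono)
      fix w assume "w \<in> space M"
      then have x: "X t w \<in> W" using t by (intro X_in) auto
      note i = int[OF t(1) x]
      have [measurable]: "(\<lambda>w'. ghat t w' (X t w)) \<in> borel_measurable M"
        using i by (rule borel_measurable_integrable)
      have "(\<integral>\<^sup>+ w'. Z w * ennreal (exp (V w \<bullet> (g t (X t w) - ghat t w' (X t w)))) \<partial>M)
        = Z w * (\<integral>\<^sup>+ w'. ennreal (exp (V w \<bullet> (g t (X t w) - ghat t w' (X t w)))) \<partial>M)"
        by (intro nn_integral_cmult) measurable
      also have "\<dots> \<le> Z w * ennreal (exp (G\<^sup>2 * (norm (V w))\<^sup>2 / 2))"
        using exp_moment_centred_inner[OF i bound[OF t(1) x], of "V w"] mean[OF t(1) x]
        by (intro mult_left_mono) simp_all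
      finally show "(\<integral>\<^sup>+ w'. Z w * ennreal (exp (V w \<bullet> (g t (X t w) - ghat t w' (X t w)))) \<partial>M)
          \<le> Z w * ennreal (exp (G\<^sup>2 * (norm (V w))\<^sup>2 / 2))" .
    qed
    finally show "(\<integral>\<^sup>+ w. Z w * ennreal (exp (V w \<bullet> (g t (X t w) - ghat t w (X t w)))) \<partial>M)
      \<le> (\<integral>\<^sup>+ w. Z w * ennreal (exp (G\<^sup>2 * (norm (V w))\<^sup>2 / 2)) \<partial>M)" .
  qed (use T steps X1 x1 XS H H_Suc X_meas sub X_in in auto)
  then show ?thesis by blast
qed

text \<open>
  On a one-point space every function is a random variable, and the noise is zero.
\<close>
lemma (in lipschitz_strongly_convex) deterministic_noisy_subgradient_run:
  assumes T: "2 \<le> T"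
    and steps: "halving_steps lam T \<alpha>"
    and y1: "y 1 \<in> W"
    and v: "\<And>t. 1 \<le> t \<Longrightarrow> t < T \<Longrightarrow> v t \<in> subdifferential F (y t)"
    and y: "\<And>t. 1 \<le> t \<Longrightarrow> t < T \<Longrightarrow> y (t + 1) = closest_point W (y t - \<alpha> t *\<^sub>R v t)"
  shows "noisy_subgradient_run W F xstar G lam (measure_pmf (return_pmf ())) T \<alpha>
           (\<lambda>_. measure_pmf (return_pmf ())) (\<lambda>t _. y t) (\<lambda>t _. v t) (\<lambda>t _. v t)"
proof -
  have y_in: "y t \<in> W" if "1 \<le> t" "t \<le> T" for t
    using that
  proof (induction t rule: nat_induct_at_least)
    case (Suc t)
    then show ?case using y[of t] projection_in by simp
  qed (rule y1)
  show ?thesis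
  proof unfold_locales
    fix t :: nat and Z :: "unit \<Rightarrow> ennreal" and V :: "unit \<Rightarrow> 'b"
    have "1 \<le> ennreal (exp (G\<^sup>2 * (norm (V ()))\<^sup>2 / 2))"
      using ennreal_leI[of 1 "exp (G\<^sup>2 * (norm (V ()))\<^sup>2 / 2)"] by simp
    from mult_left_mono[OF this, of "Z ()"]
    show "(\<integral>\<^sup>+ w. Z w * ennreal (exp (V w \<bullet> (v t - v t))) \<partial>measure_pmf (return_pmf ()))
      \<le> (\<integral>\<^sup>+ w. Z w * ennreal (exp (G\<^sup>2 * (norm (V w))\<^sup>2 / 2)) \<partial>measure_pmf (return_pmf ()))"
      by (simp add: nn_integral_return_pmf)
  next
    fix t assume "1 \<le> t" "t < T"
    then show "AE w in measure_pmf (return_pmf ()). norm (v t) \<le> G"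
      using subgradient_bound[OF y_in v] by simp
  qed (use T steps y1 v y in \<open>auto simp: subalgebra_def\<close>)
qed

theorem theorem2:
  fixes W :: "(real ^ 'n) set"
    and F :: "real ^ 'n \<Rightarrow> real"
    and xstar x1 :: "real ^ 'n"
    and M :: "'w measure"
    and g :: "nat \<Rightarrow> real ^ 'n \<Rightarrow> real ^ 'n"
    and ghat :: "nat \<Rightarrow> 'w \<Rightarrow> real ^ 'n \<Rightarrow> real ^ 'n"
    and X :: "nat \<Rightarrow> 'w \<Rightarrow> real ^ 'n"
    and \<alpha> :: "nat \<Rightarrow> real"
    and G lam :: real
    and T :: nat
  assumes "closed W" and "convex W"
    and "convex_on UNIV F"
    and "xstar \<in> W" and "\<And>y. F xstar \<le> F y"
    and "prob_space M"
    and "prob_space.indep_random_maps M W ghat {1..}"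
    and "\<And>t x. t \<ge> 1 \<Longrightarrow> x \<in> W \<Longrightarrow> integrable M (\<lambda>w. ghat t w x)"
    and "\<And>t x. t \<ge> 1 \<Longrightarrow> x \<in> W \<Longrightarrow> prob_space.expectation M (\<lambda>w. ghat t w x) = g t x"
    and "\<And>t x. t \<ge> 1 \<Longrightarrow> x \<in> W \<Longrightarrow> g t x \<in> subdifferential F x"
    and "\<And>x v. x \<in> W \<Longrightarrow> v \<in> subdifferential F x \<Longrightarrow> norm v \<le> G"
    and "\<And>t x. t \<ge> 1 \<Longrightarrow> x \<in> W \<Longrightarrow> AE w in M. norm (ghat t w x) \<le> G"
    and "lam > 0" and "strongly_convex_over lam W F"
    and "T \<ge> 1"
    and "\<And>i t. i \<le> num_phases T \<Longrightarrow> phase_time T i < t \<Longrightarrow> t \<le> phase_time T (i + 1) \<Longrightarrow>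
           \<alpha> t = (1 / 2 ^ i) * (1 / (lam * real t))"
    and "x1 \<in> W"
    and "\<And>w. w \<in> space M \<Longrightarrow> X 1 w = x1"
    and "\<And>t w. 1 \<le> t \<Longrightarrow> t < T \<Longrightarrow> w \<in> space M \<Longrightarrow>
           X (t + 1) w = closest_point W (X t w - \<alpha> t *\<^sub>R ghat t w (X t w))"
  shows "(integrable M (\<lambda>w. F (X T w)) \<and>
         prob_space.expectation M (\<lambda>w. F (X T w)) \<le> F xstar + 130 * G\<^sup>2 / (lam * real T)) \<and>
    (\<forall>\<delta>. 0 < \<delta> \<and> \<delta> \<le> 1 / exp 1 \<longrightarrow>
           prob_space.prob M {w \<in> space M.
             F (X T w) \<le> F xstar + hp_const * (G\<^sup>2 * ln (1 / \<delta>) / (lam * real T))} \<ge> 1 - \<delta>) \<and>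
    (\<forall>(y :: nat \<Rightarrow> real ^ 'n) (v :: nat \<Rightarrow> real ^ 'n).
           y 1 \<in> W \<and>
           (\<forall>t. 1 \<le> t \<and> t < T \<longrightarrow>
              v t \<in> subdifferential F (y t) \<and> y (t + 1) = closest_point W (y t - \<alpha> t *\<^sub>R v t))
           \<longrightarrow> F (y T) \<le> F xstar + 130 * G\<^sup>2 / (lam * real T))"
proof -
  interpret prob_space M by fact
  interpret lipschitz_strongly_convex W F xstar G lam
  proof
    show "subdifferential F x \<noteq> {}" if "x \<in> W" for x
      using assms(10)[of 1 x] that by auto
  qed (use assms in auto)
  note steps = halving_steps_if_phases[OF assms(16)]
  have G_term: "0 \<le> G\<^sup>2 / (lam * real T)" using lam_pos by simp
  consider "T = 1" | "2 \<le> T" using assms(15) by linarith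
  then show ?thesis
  proof cases
    \<comment> \<open>With a single time there is no step, and \<open>F\<close> being bounded on \<open>W\<close> gives the bounds.\<close>
    case 1
    have small: "F x \<le> F xstar + K * (G\<^sup>2 / lam)" if "x \<in> W" "1 \<le> K" for x K
      using gap_le[OF that(1)] mult_right_mono[OF that(2), of "G\<^sup>2 / lam"] lam_pos by simp
    have X: "F (X T w) = F x1" if "w \<in> space M" for w
      using assms(18)[OF that] 1 by simp
    have "integrable M (\<lambda>w. F (X T w))"
      using X by (subst Bochner_Integration.integrable_cong[where g = "\<lambda>_. F x1"]) auto
    moreover have "expectation (\<lambda>w. F (X T w)) = F x1"
      using X by (subst Bochner_Integration.integral_cong[where g = "\<lambda>_. F x1"]) (auto simp: prob_space)
    moreover have "{w \<in> space M. F (X T w) \<le> F xstar + hp_const * (G\<^sup>2 * ln (1 / \<delta>) / (lam * real T))}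
        = space M" if "0 < \<delta>" "\<delta> \<le> 1 / exp 1" for \<delta> :: real
    proof -
      have "1 \<le> ln (1 / \<delta>)" using that by (simp add: ln_ge_iff field_simps)
      then have "1 \<le> hp_const * ln (1 / \<delta>)" by (simp add: hp_const_def)
      from small[OF \<open>x1 \<in> W\<close> this] show ?thesis using X 1 by (auto simp: mult_ac)
    qed
    ultimately show ?thesis
      using small[of _ 130] 1 assms(17) by (auto simp: prob_space)
  next
    case 2
    obtain H where "noisy_subgradient_run W F xstar G lam M T \<alpha> H X
           (\<lambda>t w. g t (X t w)) (\<lambda>t w. ghat t w (X t w))"
      using sgd_noisy_subgradient_run[OF assms(6-10,12) 2 steps assms(17-19)] by blast
    then interpret run: noisy_subgradient_run W F xstar G lam M T \<alpha> H X
           "\<lambda>t w. g t (X t w)" "\<lambda>t w. ghat t w (X t w)" .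
    have weaken: "F xstar + 73 * G\<^sup>2 / (lam * real T) \<le> F xstar + 130 * G\<^sup>2 / (lam * real T)"
      using G_term by simp
    have "1 - \<delta> \<le> prob {w \<in> space M. F (X T w) \<le> F xstar + hp_const * (G\<^sup>2 * ln (1 / \<delta>) / (lam * real T))}"
      if \<delta>: "0 < \<delta>" "\<delta> \<le> 1 / exp 1" for \<delta> :: real
    proof -
      define L where "L = ln (1 / \<delta>)"
      have L: "1 \<le> L" unfolding L_def using \<delta> by (simp add: ln_ge_iff field_simps)
      have "exp (- L) = \<delta>" using \<delta> by (simp add: L_def ln_div)
      then have "1 - \<delta> \<le> prob {w \<in> space M. F (X T w) \<le> F xstar + 473 * (G\<^sup>2 * L / (lam * real T))}"
        using run.high_probability_last_value[OF L] by simp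
      also have "\<dots> \<le> prob {w \<in> space M. F (X T w) \<le> F xstar + hp_const * (G\<^sup>2 * L / (lam * real T))}"
      proof (rule finite_measure_mono)
        have "473 * (G\<^sup>2 * L / (lam * real T)) \<le> hp_const * (G\<^sup>2 * L / (lam * real T))"
          using L lam_pos by (intro mult_right_mono) (auto simp: hp_const_def)
        then show "{w \<in> space M. F (X T w) \<le> F xstar + 473 * (G\<^sup>2 * L / (lam * real T))}
          \<subseteq> {w \<in> space M. F (X T w) \<le> F xstar + hp_const * (G\<^sup>2 * L / (lam * real T))}"
          by auto
        note [measurable] = run.last_value_measurable
        show "{w \<in> space M. F (X T w) \<le> F xstar + hp_const * (G\<^sup>2 * L / (lam * real T))} \<in> events"
          by measurable
      qed
      finally show ?thesis by (simp add: L_def)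
    qed
    moreover have "F (y T) \<le> F xstar + 130 * G\<^sup>2 / (lam * real T)"
      if "y 1 \<in> W" "\<forall>t. 1 \<le> t \<and> t < T \<longrightarrow>
              v t \<in> subdifferential F (y t) \<and> y (t + 1) = closest_point W (y t - \<alpha> t *\<^sub>R v t)"
      for y v :: "nat \<Rightarrow> real ^ 'n"
    proof -
      interpret det: noisy_subgradient_run W F xstar G lam "measure_pmf (return_pmf ())" T \<alpha>
           "\<lambda>_. measure_pmf (return_pmf ())" "\<lambda>t _. y t" "\<lambda>t _. v t" "\<lambda>t _. v t"
        using that by (intro deterministic_noisy_subgradient_run 2 steps) auto
      show ?thesis using det.expectation_last_value weaken by simp
    qed
    ultimately show ?thesis
      using run.integrable_last_value run.expectation_last_value weaken by auto
  qed
qed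

end
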